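(* Let $\{\mathcal{T}(t)\}_{t\ge 0}$ be the symmetric telegraph process with speed $c>0$ and rate $\lambda>0$, and let $t>0$. For every integer $k\ge 1$ and $0<\beta<ct$, $$P\Bigl\{ \max_{0\le s\le t} \mathcal{T}(s) \in d\beta \,\Big|\, V(0) = c,\ N(t) = 2k+2\Bigr\} = P\Bigl\{ \max_{0\le s\le t} \mathcal{T}(s) \in d\beta \,\Big|\, V(0) = c,\ N(t) = 2k+1\Bigr\} = 2\,\frac{(2k+1)!}{k!^2}\, \frac{(c^2t^2 - \beta^2)^k}{(2ct)^{2k+1}}\,d\beta ,$$ and $$P\Bigl\{ \max_{0\le s\le t} \mathcal{T}(s) = ct \,\Big|\, V(0) = c,\ N(t) = 0\Bigr\} = 1 .$$
   Context: Let $c>0$, $\lambda>0$. Let $V(0)$ be a random variable with $P\{V(0)=c\}=P\{V(0)=-c\}=\tfrac12$ and let $\{N(t)\}_{t\ge0}$ be a homogeneous Poisson process with rate $\lambda$, independent of $V(0)$. The symmetric telegraph process is $\mathcal{T}(t)=\int_0^t V(0)(-1)^{N(s)}\,ds$, $t\ge 0$ (so $\mathcal{T}(0)=0$). A formula $P\{X\in d\beta\mid A\}=f(\beta)\,d\beta$ for $0<\beta<ct$ means that the conditional law of $X$ given the event $A$, restricted to the open interval $(0,ct)$, is absolutely continuous with density $f$. *)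

theory Defs
  imports "HOL-Probability.Probability"
begin

text \<open>
  The time parameter is a real number, but only the values \<open>N t\<close> with \<open>0 \<le> t\<close> are constrained.
  In \<open>distr_increment\<close> and \<open>indep_increments\<close>, subtraction on the natural numbers never
  truncates, because the paths are nondecreasing.
\<close>

locale poisson_process = prob_space M for M :: "'a measure" +
  fixes rate :: real and N :: "real \<Rightarrow> 'a \<Rightarrow> nat"
  assumes rate_pos: "0 < rate"
    and rv_N: "\<And>t. 0 \<le> t \<Longrightarrow> random_variable (count_space UNIV) (N t)"
    and N_zero: "\<And>\<omega>. \<omega> \<in> space M \<Longrightarrow> N 0 \<omega> = 0"
    and mono_paths: "\<And>\<omega>. \<omega> \<in> space M \<Longrightarrow> mono_on {0..} (\<lambda>t. N t \<omega>)"
    and right_continuous_paths: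
      "\<And>\<omega> t. \<omega> \<in> space M \<Longrightarrow> 0 \<le> t \<Longrightarrow> ((\<lambda>s. N s \<omega>) \<longlongrightarrow> N t \<omega>) (at_right t)"
    and distr_increment:
      "\<And>s t. 0 \<le> s \<Longrightarrow> s < t \<Longrightarrow>
        distr M (count_space UNIV) (\<lambda>\<omega>. N t \<omega> - N s \<omega>) = measure_pmf (poisson_pmf (rate * (t - s)))"
    and indep_increments:
      "\<And>(\<tau> :: nat \<Rightarrow> real) n. 0 \<le> \<tau> 0 \<Longrightarrow> incseq \<tau> \<Longrightarrow>
        indep_vars (\<lambda>_. count_space UNIV) (\<lambda>i \<omega>. N (\<tau> (Suc i)) \<omega> - N (\<tau> i) \<omega>) {..<n}"

text \<open>
  \<open>V0\<close> is the initial velocity. It is independent of the whole Poisson process: the second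
  sigma-algebra in \<open>indep_V0_N\<close> is the one generated by all \<open>N t\<close> with \<open>0 \<le> t\<close>. The library's
  \<open>indep_var\<close> is not applicable, as it requires both variables to have the same range type.
\<close>

locale symmetric_telegraph = poisson_process M rate N
  for M :: "'a measure" and rate :: real and N :: "real \<Rightarrow> 'a \<Rightarrow> nat" +
  fixes c :: real and V0 :: "'a \<Rightarrow> real"
  assumes speed_pos: "0 < c"
    and rv_V0: "random_variable borel V0"
    and prob_V0_pos: "\<P>(\<omega> in M. V0 \<omega> = c) = 1 / 2"
    and prob_V0_neg: "\<P>(\<omega> in M. V0 \<omega> = - c) = 1 / 2"
    and indep_V0_N:
      "indep_set (sets (vimage_algebra (space M) V0 borel))
        (sets (vimage_algebra (space M) (\<lambda>\<omega>. \<lambda>t\<in>{0..}. N t \<omega>)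
          (\<Pi>\<^sub>M t\<in>{0..}. count_space UNIV)))"

definition telegraph :: "('a \<Rightarrow> real) \<Rightarrow> (real \<Rightarrow> 'a \<Rightarrow> nat) \<Rightarrow> real \<Rightarrow> 'a \<Rightarrow> real" where
  "telegraph V0 N t \<omega> = integral {0..t} (\<lambda>s. V0 \<omega> * (-1) ^ N s \<omega>)"

text \<open>The supremum below is a maximum, see \<open>telegraph_max_attained\<close>.\<close>

definition telegraph_max :: "('a \<Rightarrow> real) \<Rightarrow> (real \<Rightarrow> 'a \<Rightarrow> nat) \<Rightarrow> real \<Rightarrow> 'a \<Rightarrow> real" where
  "telegraph_max V0 N t \<omega> = (SUP s\<in>{0..t}. telegraph V0 N s \<omega>)"

text \<open>
  The conditional law of \<open>X\<close> given the event \<open>A\<close>, restricted to the Borel set \<open>I\<close>, is absolutely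
  continuous with density \<open>f\<close>. The measure \<open>uniform_measure M A\<close> is \<open>M\<close> conditioned on \<open>A\<close>,
  i.e. \<open>B \<mapsto> M (A \<inter> B) / M A\<close>.
\<close>

definition has_cond_density_on ::
  "'a measure \<Rightarrow> ('a \<Rightarrow> real) \<Rightarrow> 'a set \<Rightarrow> real set \<Rightarrow> (real \<Rightarrow> real) \<Rightarrow> bool" where
  "has_cond_density_on M X A I f \<longleftrightarrow>
     X \<in> borel_measurable M \<and>
     f \<in> borel_measurable (restrict_space borel I) \<and> (\<forall>x\<in>I. 0 \<le> f x) \<and>
     restrict_space (distr (uniform_measure M A) borel X) I =
       density (restrict_space lborel I) (\<lambda>x. ennreal (f x))"

context symmetric_telegraph
begin

lemma telegraph_integrable:
  assumes "\<omega> \<in> space M"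
  shows "(\<lambda>s. V0 \<omega> * (-1) ^ N s \<omega>) integrable_on {0..t}"
proof -
  have "mono_on {0..t} (\<lambda>s. real (N s \<omega>))"
    using mono_paths[OF assms] by (auto simp: monotone_on_def)
  then have "(\<lambda>s. real (N s \<omega>)) \<in> borel_measurable (restrict_space borel {0..t})"
    by (rule borel_measurable_mono_on_fnc)
  then have "(\<lambda>s. nat \<lfloor>real (N s \<omega>)\<rfloor>) \<in> measurable (restrict_space borel {0..t}) (count_space UNIV)"
    by measurable
  then have N: "(\<lambda>s. N s \<omega>) \<in> measurable (restrict_space borel {0..t}) (count_space UNIV)"
    by simp
  have "(\<lambda>s. V0 \<omega> * (-1) ^ N s \<omega>) \<in> borel_measurable (restrict_space borel {0..t})"
    using N by (rule measurable_compose) simp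
  then have "(\<lambda>s. indicator {0..t} s *\<^sub>R (V0 \<omega> * (-1) ^ N s \<omega>)) \<in> borel_measurable borel"
    by (subst (asm) borel_measurable_restrict_space_iff) auto
  then have "set_integrable lborel {0..t} (\<lambda>s. V0 \<omega> * (-1) ^ N s \<omega>)"
    unfolding set_integrable_def
    by (intro integrableI_bounded_set_indicator[where B = "\<bar>V0 \<omega>\<bar>"] integrableI_bounded_set[where A="{0..t}" and B = "\<bar>V0 \<omega>\<bar>"])
       (auto simp: abs_mult power_abs emeasure_lborel_Icc_eq indicator_def)
  then show ?thesis
    by (rule set_borel_integral_eq_integral)
qed

lemma telegraph_max_attained:
  assumes "\<omega> \<in> space M" "0 \<le> t"
  shows "\<exists>s\<in>{0..t}. telegraph_max V0 N t \<omega> = telegraph V0 N s \<omega>"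
proof -
  have "continuous_on {0..t} (\<lambda>s. telegraph V0 N s \<omega>)"
    unfolding telegraph_def
    by (rule indefinite_integral_continuous_1[OF telegraph_integrable[OF assms(1)]])
  then obtain s where s: "s \<in> {0..t}"
      "\<And>u. u \<in> {0..t} \<Longrightarrow> telegraph V0 N u \<omega> \<le> telegraph V0 N s \<omega>"
    using continuous_attains_sup[of "{0..t}" "\<lambda>s. telegraph V0 N s \<omega>"] assms(2) by auto
  then have "telegraph_max V0 N t \<omega> = telegraph V0 N s \<omega>"
    unfolding telegraph_max_def by (intro cSup_eq_maximum) auto
  with s(1) show ?thesis
    by blast
qed

end

end

theory Submission
  imports Defs
begin

text \<open>
  Cut \<open>[0, t]\<close> into \<open>m\<close> equal cells. Up to an event of vanishing probability each cell contains at most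
  one jump, and then all sets of \<open>n\<close> cells are equally likely to be the cells with a jump; so the law of
  the maximum is governed by the number of \<open>\<plusminus>1\<close> walks of length \<open>m\<close> with \<open>n\<close> switches that reach a given
  level. If the walk starts upwards and the level is \<open>a - b\<close> with \<open>a + b = m\<close>, this number is
  \<open>\<Sum>r\<le>n. w r (n - r) * (a choose r) * (b choose (n - r))\<close> with \<open>w r s = 2, 1, 0\<close> according to
  \<open>r < s\<close>, \<open>r = s\<close>, \<open>r > s\<close>: there is a companion formula for walks that start downwards, and the
  pair satisfies the one-step recursion by Pascal's rule, while at level \<open>0\<close> the symmetry
  \<open>w r s + w s r = 2\<close> reduces the sum to Vandermonde's identity.

  As \<open>m\<close> grows, binomial coefficients become powers, and the counts tend to a polynomial in the level.
  In its derivative all terms telescope except those where the weight changes, which leaves the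
  stated density. The true maximum differs from the one of the walk by at most
  \<open>c (t / m) (2 n + 1)\<close>, so continuity of the limit in the level transfers it to the telegraph process.
\<close>

subsection \<open>Counting walks that reach a level\<close>

definition reflect_weight :: "nat \<Rightarrow> nat \<Rightarrow> nat" where
  "reflect_weight r s = (if r < s then 2 else if r = s then 1 else 0)"

text \<open>The bits mark the switches: a set bit flips the velocity \<open>v\<close> before the step it belongs to;
  \<open>h\<close> is the height still to be climbed.\<close>

fun reaches :: "int \<Rightarrow> int \<Rightarrow> bool list \<Rightarrow> bool" where
  "reaches v h [] \<longleftrightarrow> h \<le> 0"
| "reaches v h (x # xs) \<longleftrightarrow> h \<le> 0 \<or> (let v' = (if x then - v else v) in reaches v' (h - v') xs)"

definition reaching :: "int \<Rightarrow> int \<Rightarrow> nat \<Rightarrow> nat \<Rightarrow> bool list set" where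
  "reaching v h m n = {xs. length xs = m \<and> count_list xs True = n \<and> reaches v h xs}"

lemma reaches_nonpos: "h \<le> 0 \<Longrightarrow> reaches v h xs"
  by (cases xs) auto

lemma reaches_le_length: "\<bar>v\<bar> = 1 \<Longrightarrow> reaches v h xs \<Longrightarrow> h \<le> int (length xs)"
proof (induction xs arbitrary: v h)
  case (Cons x xs)
  let ?v = "if x then - v else v"
  have "h \<le> 0 \<or> reaches ?v (h - ?v) xs" "\<bar>?v\<bar> = 1"
    using Cons.prems by (auto simp: Let_def)
  then show ?case
    using Cons.IH[of ?v "h - ?v"] by (auto split: if_splits)
qed simp

text \<open>The recursion unfolds to a condition on partial sums, the form that can be compared with
  \<open>grid_walk\<close>. The sign of step \<open>j\<close> counts \<open>Suc j\<close> bits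
  because a bit flips the velocity before its own step.\<close>

lemma reaches_iff:
  "reaches v h xs \<longleftrightarrow>
    (\<exists>i\<le>length xs. h \<le> (\<Sum>j<i. v * (-1) ^ count_list (take (Suc j) xs) True))"
proof (induction xs arbitrary: v h)
  case (Cons x xs)
  let ?v = "if x then - v else v"
  have shift: "(\<Sum>j<Suc i. v * (-1) ^ count_list (take (Suc j) (x # xs)) True) =
      ?v + (\<Sum>j<i. ?v * (-1) ^ count_list (take (Suc j) xs) True)" for i
    by (subst sum.lessThan_Suc_shift) (simp del: take_Suc_Cons sum.lessThan_Suc, simp)
  have "(\<exists>i\<le>length (x # xs). h \<le> (\<Sum>j<i. v * (-1) ^ count_list (take (Suc j) (x # xs)) True)) \<longleftrightarrow>
      h \<le> 0 \<or> (\<exists>i\<le>length xs. h \<le> (\<Sum>j<Suc i. v * (-1) ^ count_list (take (Suc j) (x # xs)) True))"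
    (is "(\<exists>i\<le>_. ?P i) \<longleftrightarrow> _ \<or> (\<exists>i\<le>_. ?P (Suc i))")
  proof -
    have "(\<exists>i\<le>length (x # xs). ?P i) \<longleftrightarrow> ?P 0 \<or> (\<exists>i\<le>length xs. ?P (Suc i))"
      by (metis (no_types, lifting) Suc_le_mono le0 length_Cons not0_implies_Suc)
    then show ?thesis by simp
  qed
  also have "\<dots> \<longleftrightarrow> h \<le> 0 \<or>
      (\<exists>i\<le>length xs. h \<le> ?v + (\<Sum>j<i. ?v * (-1) ^ count_list (take (Suc j) xs) True))"
    by (simp only: shift)
  also have "\<dots> \<longleftrightarrow> reaches v h (x # xs)"
    unfolding reaches.simps Let_def Cons.IH by (simp add: diff_le_eq add.commute)
  finally show ?case ..
qed simp

lemma finite_reaching [simp]: "finite (reaching v h m n)"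
  by (rule finite_subset[OF _ finite_lists_length_eq[of UNIV m]]) (auto simp: reaching_def)

text \<open>Case split on the first bit. The hypothesis \<open>0 < h\<close> rules out success
  before any step, so reaching is decided by the tail; a set bit uses up one switch, which is
  impossible for \<open>n = 0\<close>.\<close>

lemma reaching_Suc:
  assumes "0 < h"
  shows "reaching v h (Suc m) n = (#) False ` reaching v (h - v) m n \<union>
    (if n = 0 then {} else (#) True ` reaching (- v) (h + v) m (n - 1))"
  using assms
  by (force simp: reaching_def length_Suc_conv Let_def image_iff split: if_splits)

lemma card_reaching_Suc:
  assumes "0 < h"
  shows "card (reaching v h (Suc m) n) = card (reaching v (h - v) m n) +
    (if n = 0 then 0 else card (reaching (- v) (h + v) m (n - 1)))"
  unfolding reaching_Suc[OF assms]
  by (subst card_Un_disjoint) (auto simp: card_image)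

text \<open>The level is met at the start, so every placement of the \<open>n\<close> set bits
  counts. This gives both the boundary value of the recursion and the total number of walks.\<close>

lemma card_reaching_nonpos: "h \<le> 0 \<Longrightarrow> card (reaching v h m n) = m choose n"
proof -
  have "card {xs. length xs = m \<and> count_list xs True = n} = m choose n"
  proof (induction m arbitrary: n)
    case 0
    have "{xs :: bool list. length xs = 0 \<and> count_list xs True = n} = (if n = 0 then {[]} else {})"
      by auto
    then show ?case by (cases n) auto
  next
    case (Suc m)
    let ?B = "\<lambda>m n. {xs. length xs = m \<and> count_list xs True = n}"
    have fin: "finite (?B m n)" for n
      by (rule finite_subset[OF _ finite_lists_length_eq[of UNIV m]]) auto
    have "?B (Suc m) n = (#) False ` ?B m n \<union> (if n = 0 then {} else (#) True ` ?B m (n - 1))"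
      by (force simp: length_Suc_conv image_iff split: if_splits)
    then have "card (?B (Suc m) n) = card (?B m n) + (if n = 0 then 0 else card (?B m (n - 1)))"
      by (simp, subst card_Un_disjoint) (auto simp: card_image fin)
    then show ?case
      using Suc.IH by (cases n) auto
  qed
  then show "h \<le> 0 \<Longrightarrow> ?thesis"
    by (simp add: reaching_def reaches_nonpos)
qed

lemma reaching_empty: "\<bar>v\<bar> = 1 \<Longrightarrow> int m < h \<Longrightarrow> reaching v h m n = {}"
  using reaches_le_length by (force simp: reaching_def)

section \<open>The closed form of the counts\<close>

definition reach_count :: "nat \<Rightarrow> nat \<Rightarrow> nat \<Rightarrow> nat" where
  "reach_count n a b = (\<Sum>r\<le>n. reflect_weight r (n - r) * (a choose r) * (b choose (n - r)))"

text \<open>The companion for walks that start downwards, at level \<open>a + 2 - b\<close>: a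
  switch on the first step from level \<open>Suc a - b\<close> leaves height
  \<open>a + 2 - b\<close> and velocity -1.\<close>

definition reach_count_down :: "nat \<Rightarrow> nat \<Rightarrow> nat \<Rightarrow> nat" where
  "reach_count_down n a b = (\<Sum>r\<le>n. reflect_weight (Suc r) (n - r) * (a choose r) * (b choose (n - r)))"

text \<open>Pascal's rule in \<open>a\<close>: in the part with \<open>a choose (r - 1)\<close>,
  shifting \<open>r\<close> by one turns the weight into that of the downward count.\<close>

lemma reach_count_Suc:
  "reach_count n (Suc a) b = reach_count n a b + (if n = 0 then 0 else reach_count_down (n - 1) a b)"
proof (cases n)
  case (Suc k)
  show ?thesis
    unfolding Suc reach_count_def reach_count_down_def
    by (subst (1 2) sum.atMost_Suc_shift) (simp add: algebra_simps sum.distrib)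
qed (simp add: reach_count_def)

text \<open>For \<open>b = 0\<close> only \<open>r = n\<close> has a nonzero binomial, and there the
  weight is \<open>reflect_weight (Suc n) 0 = 0\<close>.\<close>

lemma reach_count_down_0: "reach_count_down n a 0 = 0"
  unfolding reach_count_down_def
  by (rule sum.neutral) (auto simp: reflect_weight_def binomial_eq_0_iff)

text \<open>Pascal's rule in \<open>b\<close>. The weight depends only on the order of its
  arguments, so lowering both by one turns the shifted weight into that of
  \<open>reach_count\<close>.\<close>

lemma reach_count_down_Suc:
  "reach_count_down n a (Suc b) =
    reach_count_down n a b + (if n = 0 then 0 else reach_count (n - 1) a b)"
proof (cases n)
  case (Suc k)
  have "reflect_weight (Suc r) (Suc k - r) * (a choose r) * (Suc b choose (Suc k - r)) =
      reflect_weight (Suc r) (Suc k - r) * (a choose r) * (b choose (Suc k - r)) +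
      reflect_weight r (k - r) * (a choose r) * (b choose (k - r))" if "r \<le> k" for r
    using that by (simp add: Suc_diff_le reflect_weight_def algebra_simps)
  then show ?thesis
    unfolding Suc reach_count_def reach_count_down_def
    by (simp add: reflect_weight_def sum.distrib)
qed (simp add: reach_count_down_def reflect_weight_def)

lemma reach_count_diagonal: "reach_count n a a = (a + a) choose n"
proof -
  have "reach_count n a a = (\<Sum>r\<le>n. reflect_weight (n - r) r * (a choose r) * (a choose (n - r)))"
    unfolding reach_count_def
    by (rule sum.reindex_bij_witness[where i = "\<lambda>r. n - r" and j = "\<lambda>r. n - r"]) auto
  then have "2 * reach_count n a a =
      (\<Sum>r\<le>n. (reflect_weight r (n - r) + reflect_weight (n - r) r) * (a choose r) * (a choose (n - r)))"
    by (simp add: reach_count_def sum.distrib algebra_simps)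
  also have "\<dots> = (\<Sum>r\<le>n. 2 * ((a choose r) * (a choose (n - r))))"
    by (intro sum.cong) (auto simp: reflect_weight_def)
  also have "\<dots> = 2 * ((a + a) choose n)"
    by (simp add: vandermonde flip: sum_distrib_left)
  finally show ?thesis by simp
qed

text \<open>Simultaneous induction on the length \<open>a + b\<close>: both sides obey the same
  first-step recursion. The upward level is 0 exactly when \<open>a = b\<close>, where the recursion
  fails and the diagonal value takes over. The downward level is always at least 1; its boundary is
  \<open>b = 0\<close>, where the level \<open>a + 2\<close> exceeds the number of steps.\<close>

lemma card_reaching:
  shows "b \<le> a \<Longrightarrow> card (reaching 1 (int a - int b) (a + b) n) = reach_count n a b"
    and "b \<le> Suc a \<Longrightarrow> card (reaching (- 1) (int a + 2 - int b) (a + b) n) = reach_count_down n a b"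
proof (induction "a + b" arbitrary: a b n rule: less_induct)
  case less
  {
    case 1
    show ?case
    proof (cases "a = b")
      case True
      then show ?thesis by (simp add: card_reaching_nonpos reach_count_diagonal)
    next
      case False
      with 1 obtain a' where a': "a = Suc a'" "b \<le> a'" by (cases a) auto
      have "card (reaching 1 (int a - int b) (Suc (a' + b)) n) =
          card (reaching 1 (int a' - int b) (a' + b) n) +
          (if n = 0 then 0 else card (reaching (- 1) (int a' + 2 - int b) (a' + b) (n - 1)))"
        using a' by (subst card_reaching_Suc) (auto simp: algebra_simps)
      also have "\<dots> = reach_count n a b"
        using less(1)[of a' b n] less(2)[of a' b "n - 1"] a' by (simp add: reach_count_Suc)
      finally show ?thesis using a' by simp
    qed
  next
    case 2
    show ?case
    proof (cases b)
      case 0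
      then show ?thesis by (simp add: reaching_empty reach_count_down_0)
    next
      case (Suc b')
      have "card (reaching (- 1) (int a + 2 - int b) (Suc (a + b')) n) =
          card (reaching (- 1) (int a + 2 - int b') (a + b') n) +
          (if n = 0 then 0 else card (reaching 1 (int a - int b') (a + b') (n - 1)))"
        using 2 Suc by (subst card_reaching_Suc) (auto simp: algebra_simps)
      also have "\<dots> = reach_count_down n a b"
        using less(2)[of a b' n] less(1)[of a b' "n - 1"] 2 Suc by (simp add: reach_count_down_Suc)
      finally show ?thesis using Suc by simp
    qed
  }
qed

subsection \<open>The limit of the counts\<close>

text \<open>Induction on \<open>r\<close>: going from \<open>r\<close> to \<open>Suc r\<close>
  multiplies the scaled coefficient by \<open>(a m / m - r / m) / Suc r\<close>. The underlying
  absorption identity is also true over the reals for \<open>n < r\<close>, where both of its sides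
  vanish.\<close>

lemma tendsto_binomial_scaled:
  fixes x :: real
  assumes "(\<lambda>m. real (a m) / real m) \<longlonglongrightarrow> x"
  shows "(\<lambda>m. real (a m choose r) / real m ^ r) \<longlonglongrightarrow> x ^ r / fact r"
proof (induction r)
  case (Suc r)
  have absorb: "real (Suc r) * real (n choose Suc r) = real (n choose r) * (real n - real r)" for n
  proof (cases "r \<le> n")
    case True
    have "Suc r * (n choose Suc r) = (n choose r) * (n - r)"
      using binomial_absorb_comp[of n r] Suc_times_binomial_eq[of "n - 1" r]
      by (cases n) (auto simp: algebra_simps)
    with True show ?thesis
      by (metis of_nat_diff of_nat_mult)
  qed (simp add: binomial_eq_0)
  have "(\<lambda>m. real (a m choose r) / real m ^ r * ((real (a m) / real m - real r / real m) / real (Suc r)))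
      \<longlonglongrightarrow> x ^ r / fact r * ((x - 0) / real (Suc r))"
    by (intro tendsto_mult Suc.IH tendsto_divide tendsto_diff assms tendsto_const
        tendsto_divide_0[OF tendsto_const] filterlim_real_at_infinity_sequentially
        filterlim_at_top_imp_at_infinity filterlim_real_sequentially) auto
  moreover have "real (a m choose r) / real m ^ r * ((real (a m) / real m - real r / real m) / real (Suc r))
      = real (a m choose Suc r) / real m ^ Suc r" for m
    using absorb[of "a m"] by (simp add: divide_simps) (auto simp: algebra_simps)
  ultimately show ?case
    by (simp add: mult_ac)
qed simp

definition reach_poly :: "nat \<Rightarrow> real \<Rightarrow> real \<Rightarrow> real" where
  "reach_poly n x y = (\<Sum>r\<le>n. real (reflect_weight r (n - r)) * (x ^ r / fact r) * (y ^ (n - r) / fact (n - r)))"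

lemma tendsto_reach_count:
  assumes "(\<lambda>m. real (a m) / real m) \<longlonglongrightarrow> x" "(\<lambda>m. real (b m) / real m) \<longlonglongrightarrow> y"
  shows "(\<lambda>m. real (reach_count n (a m) (b m)) / real m ^ n) \<longlonglongrightarrow> reach_poly n x y"
proof -
  have "(\<lambda>m. \<Sum>r\<le>n. real (reflect_weight r (n - r)) * (real (a m choose r) / real m ^ r) *
      (real (b m choose (n - r)) / real m ^ (n - r))) \<longlonglongrightarrow> reach_poly n x y"
    unfolding reach_poly_def
    by (intro tendsto_sum tendsto_mult tendsto_const tendsto_binomial_scaled assms)
  moreover have "(\<Sum>r\<le>n. real (reflect_weight r (n - r)) * (real (a m choose r) / real m ^ r) *
      (real (b m choose (n - r)) / real m ^ (n - r))) = real (reach_count n (a m) (b m)) / real m ^ n" for m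
    unfolding reach_count_def of_nat_sum sum_divide_distrib
    by (intro sum.cong refl) (simp flip: power_add)
  ultimately show ?thesis by simp
qed

text \<open>The symmetry argument of \<open>reach_count_diagonal\<close>, with the binomial theorem
  in place of Vandermonde's identity.\<close>

lemma reach_poly_diagonal: "reach_poly n x x = (2 * x) ^ n / fact n"
proof -
  let ?e = "\<lambda>r. x ^ r / fact r * (x ^ (n - r) / fact (n - r))"
  have "reach_poly n x x = (\<Sum>r\<le>n. real (reflect_weight (n - r) r) * ?e r)"
    unfolding reach_poly_def
    by (rule sum.reindex_bij_witness[where i = "\<lambda>r. n - r" and j = "\<lambda>r. n - r"]) (auto simp: mult_ac)
  then have "2 * reach_poly n x x =
      (\<Sum>r\<le>n. real (reflect_weight r (n - r) + reflect_weight (n - r) r) * ?e r)"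
    unfolding mult_2 by (subst (1) reach_poly_def) (simp add: sum.distrib distrib_right mult.assoc add_divide_distrib)
  also have "\<dots> = (\<Sum>r\<le>n. 2 * (real (n choose r) * x ^ r * x ^ (n - r) / fact n))"
    by (intro sum.cong) (auto simp: reflect_weight_def binomial_fact)
  also have "\<dots> = 2 * ((2 * x) ^ n / fact n)"
    using binomial_ring[of x x n] by (simp flip: sum_distrib_left sum_divide_distrib)
  finally show ?thesis by simp
qed

lemma reach_poly_0: "0 < n \<Longrightarrow> reach_poly n x 0 = 0"
  unfolding reach_poly_def
  by (rule sum.neutral) (auto simp: reflect_weight_def power_0_left)

lemma DERIV_divided_power:
  "((\<lambda>x::real. x ^ r / fact r) has_field_derivative (if r = 0 then 0 else x ^ (r - 1) / fact (r - 1))) (at x)"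
proof (cases r)
  case (Suc l)
  have "((\<lambda>x::real. x ^ r / fact r) has_field_derivative (real r * x ^ (r - 1)) / fact r) (at x)"
    by (auto intro!: derivative_eq_intros)
  then show ?thesis
    by (simp add: Suc del: of_nat_Suc)
qed simp

section \<open>The survival function of the maximum and its derivative\<close>

text \<open>\<open>max_survival n (\<beta> / (c t))\<close> is the probability that the maximum exceeds \<open>\<beta>\<close>,
  given \<open>n\<close> switches and positive initial velocity.\<close>

definition max_survival :: "nat \<Rightarrow> real \<Rightarrow> real" where
  "max_survival n z = fact n * reach_poly n ((1 + z) / 2) ((1 - z) / 2)"

lemma max_survival_0: "max_survival n 0 = 1"
  by (simp add: max_survival_def reach_poly_diagonal)

lemma max_survival_1: "0 < n \<Longrightarrow> max_survival n 1 = 0"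
  by (simp add: max_survival_def reach_poly_0)

text \<open>Divided powers differentiate to divided powers without extra factors. The two parts of
  the product rule thus give the same monomials with neighbouring weights and opposite signs, and
  the coefficients become weight differences.\<close>

lemma DERIV_reach_poly:
  fixes z :: real
  defines "x \<equiv> (1 + z) / 2" and "y \<equiv> (1 - z) / 2"
  shows "((\<lambda>z. reach_poly (Suc l) ((1 + z) / 2) ((1 - z) / 2)) has_field_derivative
    (\<Sum>r\<le>l. (real (reflect_weight (Suc r) (l - r)) - real (reflect_weight r (Suc l - r))) / 2 *
      (x ^ r / fact r) * (y ^ (l - r) / fact (l - r)))) (at z)"
proof -
  define e where "e = (\<lambda>r (x::real). x ^ r / fact r)"
  define e' where "e' = (\<lambda>r (x::real). if r = 0 then 0 else e (r - 1) x)"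
  have e: "(e r has_field_derivative e' r x) (at x)" for r x
    unfolding e_def e'_def by (rule DERIV_divided_power)
  have ex: "((\<lambda>z. e r ((1 + z) / 2)) has_field_derivative e' r x / 2) (at z)" for r
  proof -
    have "((\<lambda>z. (1 + z) / 2) has_field_derivative 1 / 2) (at z)"
      by (auto intro!: derivative_eq_intros)
    from DERIV_chain2[OF e this, of r] show ?thesis by (simp add: x_def)
  qed
  have ey: "((\<lambda>z. e r ((1 - z) / 2)) has_field_derivative - (e' r y / 2)) (at z)" for r
  proof -
    have "((\<lambda>z. (1 - z) / 2) has_field_derivative - 1 / 2) (at z)"
      by (auto intro!: derivative_eq_intros)
    from DERIV_chain2[OF e this, of r] show ?thesis by (simp add: y_def)
  qed
  have "((\<lambda>z. \<Sum>r\<le>Suc l. real (reflect_weight r (Suc l - r)) * e r ((1 + z) / 2) * e (Suc l - r) ((1 - z) / 2))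
      has_field_derivative
      (\<Sum>r\<le>Suc l. real (reflect_weight r (Suc l - r)) * (e' r x / 2) * e (Suc l - r) y -
        real (reflect_weight r (Suc l - r)) * e r x * (e' (Suc l - r) y / 2))) (at z)"
    by (intro DERIV_sum) (rule derivative_eq_intros ex ey refl | simp add: x_def y_def mult_ac)+
  also have "(\<Sum>r\<le>Suc l. real (reflect_weight r (Suc l - r)) * (e' r x / 2) * e (Suc l - r) y -
        real (reflect_weight r (Suc l - r)) * e r x * (e' (Suc l - r) y / 2)) =
      (\<Sum>r\<le>Suc l. real (reflect_weight r (Suc l - r)) * (e' r x / 2) * e (Suc l - r) y) -
      (\<Sum>r\<le>Suc l. real (reflect_weight r (Suc l - r)) * e r x * (e' (Suc l - r) y / 2))"
    by (rule sum_subtractf)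
  \<comment> \<open>The first sum loses its term \<open>r = 0\<close> and the second its term
    \<open>r = Suc l\<close>, since \<open>e' 0\<close> is 0; then the first is shifted by
    one.\<close>
  also have "\<dots> = (\<Sum>r\<le>l. real (reflect_weight (Suc r) (l - r)) * (e r x / 2) * e (l - r) y) -
      (\<Sum>r\<le>l. real (reflect_weight r (Suc l - r)) * e r x * (e (l - r) y / 2))"
    by (subst (1) sum.atMost_Suc_shift) (simp add: e'_def)
  also have "\<dots> = (\<Sum>r\<le>l. (real (reflect_weight (Suc r) (l - r)) - real (reflect_weight r (Suc l - r))) / 2 *
      e r x * e (l - r) y)"
    by (simp add: algebra_simps diff_divide_distrib flip: sum_subtractf)
  finally show ?thesis
    unfolding reach_poly_def e_def .
qed

text \<open>Only the terms of the derivative near the diagonal survive, as the weights are constant off it.\<close>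

lemma DERIV_max_survival:
  assumes "n \<in> {2 * k + 2, 2 * k + 1}"
  shows "(max_survival n has_field_derivative
    - (fact (2 * k + 1) / (fact k)\<^sup>2 * ((1 - z\<^sup>2) ^ k / 4 ^ k))) (at z)"
proof -
  define x y where "x = (1 + z) / 2" and "y = (1 - z) / 2"
  have xy: "x * y = (1 - z\<^sup>2) / 4" "x + y = 1"
    by (simp_all add: x_def y_def power2_eq_square field_simps)
  define T where "T = (\<lambda>l r. (real (reflect_weight (Suc r) (l - r)) - real (reflect_weight r (Suc l - r))) / 2 *
      (x ^ r / fact r) * (y ^ (l - r) / fact (l - r)))"
  have deriv: "(max_survival (Suc l) has_field_derivative fact (Suc l) * (\<Sum>r\<le>l. T l r)) (at z)" for l
    unfolding max_survival_def[abs_def] T_def x_def y_def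
    by (intro DERIV_cmult DERIV_reach_poly)
  have pow: "x ^ k * y ^ k = (1 - z\<^sup>2) ^ k / 4 ^ k"
    by (simp add: xy power_divide flip: power_mult_distrib)
  from assms consider "n = Suc (2 * k)" | "n = Suc (2 * k + 1)" by auto
  then show ?thesis
  proof cases
    case 1
    \<comment> \<open>The weight difference is -1, -2, -1 for \<open>l - 2 * r\<close> equal to 1,
      0, -1 (as integers) and 0 otherwise. For \<open>l = 2 * k\<close> this offset is even, so only
      \<open>r = k\<close> remains.\<close>
    have "(\<Sum>r\<le>2 * k. T (2 * k) r) = (\<Sum>r\<in>{k}. T (2 * k) r)"
      by (rule sum.mono_neutral_right) (auto simp: T_def reflect_weight_def)
    also have "\<dots> = - (x ^ k * y ^ k) / (fact k)\<^sup>2"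
      by (simp add: T_def reflect_weight_def power2_eq_square)
    finally show ?thesis
      using deriv[of "2 * k"] 1 by (simp add: pow mult_ac)
  next
    case 2
    \<comment> \<open>Now the offset is odd, so two terms remain, each with weight difference -1.
      They combine through \<open>x + y = 1\<close>, which is why both parities lead to the same
      density.\<close>
    have "(\<Sum>r\<le>2 * k + 1. T (2 * k + 1) r) = (\<Sum>r\<in>{k, Suc k}. T (2 * k + 1) r)"
      by (rule sum.mono_neutral_right) (auto simp: T_def reflect_weight_def)
    also have "\<dots> = - (x ^ k * y ^ k * (x + y)) / (2 * fact k * fact (Suc k))"
    proof -
      have quot: "(- 1) / 2 * (a / b) * (c / d) = - (a * c) / (2 * b * d)" for a b c d :: real
        by simp
      have "T (2 * k + 1) k = (- 1) / 2 * (x ^ k / fact k) * (y ^ Suc k / fact (Suc k))"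
      proof -
        have "2 * k + 1 - k = Suc k" "Suc (2 * k + 1) - k = Suc (Suc k)" by simp_all
        then show ?thesis
          unfolding T_def by (simp only:) (simp add: reflect_weight_def del: fact_Suc power_Suc)
      qed
      moreover have "T (2 * k + 1) (Suc k) = (- 1) / 2 * (x ^ Suc k / fact (Suc k)) * (y ^ k / fact k)"
      proof -
        have "2 * k + 1 - Suc k = k" "Suc (2 * k + 1) - Suc k = Suc k" by simp_all
        then show ?thesis
          unfolding T_def by (simp only:) (simp add: reflect_weight_def del: fact_Suc power_Suc)
      qed
      ultimately have "(\<Sum>r\<in>{k, Suc k}. T (2 * k + 1) r) =
          - (x ^ k * y ^ Suc k) / (2 * fact k * fact (Suc k)) - (x ^ Suc k * y ^ k) / (2 * fact (Suc k) * fact k)"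
        by (simp only: quot) simp
      also have "\<dots> = - (x ^ k * y ^ k * (x + y)) / (2 * fact k * fact (Suc k))"
        by (simp add: distrib_left distrib_right mult_ac add_divide_distrib diff_divide_distrib del: fact_Suc)
      finally show ?thesis .
    qed
    finally have *: "(\<Sum>r\<le>2 * k + 1. T (2 * k + 1) r) = - (x ^ k * y ^ k) / (2 * fact k * fact (Suc k))"
      by (simp add: xy)
    \<comment> \<open>The extra factor \<open>2 * Suc k\<close> of the factorial cancels the 2 and
      the \<open>Suc k\<close> of the denominator.\<close>
    have "fact (Suc (2 * k + 1)) * (\<Sum>r\<le>2 * k + 1. T (2 * k + 1) r) =
        - (fact (2 * k + 1) / (fact k)\<^sup>2 * (x ^ k * y ^ k))"
    proof -
      have cancel: "2 * s * F * (- P / (2 * f * (s * f))) = - (F / f\<^sup>2 * P)" if "s \<noteq> 0" for s F P f :: real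
        using that by (simp add: power2_eq_square)
      have "fact (Suc (2 * k + 1)) = 2 * real (Suc k) * fact (2 * k + 1)"
        by (subst fact_Suc) simp
      then show ?thesis
        unfolding * fact_Suc[of k] by (simp only: cancel of_nat_neq_0 not_False_eq_True)
    qed
    then show ?thesis
      using deriv[of "2 * k + 1"] 2 by (simp only: pow Suc_eq_plus1)
  qed
qed

subsection \<open>Discretisation of the paths\<close>

text \<open>The velocity is sampled at the right end of each cell, so that a jump acts on the whole cell in
  which it occurs, as in \<open>reaches\<close>.\<close>

definition grid_walk :: "(real \<Rightarrow> 'a \<Rightarrow> nat) \<Rightarrow> real \<Rightarrow> nat \<Rightarrow> 'a \<Rightarrow> int" where
  "grid_walk N \<delta> i \<omega> = (\<Sum>j<i. (-1) ^ N (real (Suc j) * \<delta>) \<omega>)"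

text \<open>\<open>M\<close> is an arbitrary measure here, so that the lemma also applies to the
  sigma-algebra generated by the Poisson paths, where independence of the velocity is used.\<close>

lemma measurable_grid_walk:
  assumes "\<And>s. 0 \<le> s \<Longrightarrow> N s \<in> measurable M (count_space UNIV)" "0 \<le> \<delta>"
  shows "grid_walk N \<delta> i \<in> measurable M (count_space UNIV)"
proof -
  have [measurable]: "N (real j * \<delta>) \<in> measurable M (count_space UNIV)" for j
    using assms by simp
  have "(\<lambda>\<omega>. \<Sum>j<i. (-1 :: real) ^ N (real (Suc j) * \<delta>) \<omega>) \<in> borel_measurable M"
    by measurable
  then have "(\<lambda>\<omega>. \<lfloor>\<Sum>j<i. (-1 :: real) ^ N (real (Suc j) * \<delta>) \<omega>\<rfloor>) \<in> measurable M (count_space UNIV)"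
    by measurable
  moreover have "\<lfloor>\<Sum>j<i. (-1 :: real) ^ N (real (Suc j) * \<delta>) \<omega>\<rfloor> = grid_walk N \<delta> i \<omega>" for \<omega>
  proof -
    have "(\<Sum>j<i. (-1 :: real) ^ N (real (Suc j) * \<delta>) \<omega>) = of_int (grid_walk N \<delta> i \<omega>)"
      by (simp add: grid_walk_def)
    then show ?thesis by simp
  qed
  ultimately show ?thesis by (simp add: fun_eq_iff cong: measurable_cong)
qed

context symmetric_telegraph
begin

lemma telegraph_diff:
  assumes "\<omega> \<in> space M" "0 \<le> s" "s \<le> u"
  shows "telegraph V0 N u \<omega> - telegraph V0 N s \<omega> = integral {s..u} (\<lambda>s. V0 \<omega> * (-1) ^ N s \<omega>)"
  unfolding telegraph_def
  using Henstock_Kurzweil_Integration.integral_combine[OF assms(2,3) telegraph_integrable[OF assms(1)]] by simp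

lemma telegraph_integrable_subinterval:
  assumes "\<omega> \<in> space M" "0 \<le> s"
  shows "(\<lambda>s. V0 \<omega> * (-1) ^ N s \<omega>) integrable_on {s..u}"
  by (rule integrable_subinterval_real[OF telegraph_integrable[OF assms(1), of u]])
    (use assms(2) in auto)

lemma telegraph_lipschitz:
  assumes "\<omega> \<in> space M" "0 \<le> s" "s \<le> u"
  shows "\<bar>telegraph V0 N u \<omega> - telegraph V0 N s \<omega>\<bar> \<le> \<bar>V0 \<omega>\<bar> * (u - s)"
proof -
  have "norm (integral {s..u} (\<lambda>s. V0 \<omega> * (-1) ^ N s \<omega>)) \<le> \<bar>V0 \<omega>\<bar> * Henstock_Kurzweil_Integration.content (cbox s u)"
    unfolding cbox_interval
    by (rule has_integral_bound_real[OF _ finite.emptyI integrable_integral])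
      (use telegraph_integrable_subinterval[OF assms(1,2), of u] in \<open>auto simp: abs_mult power_abs\<close>)
  then show ?thesis
    using assms by (simp add: telegraph_diff)
qed

lemma telegraph_const_cell:
  assumes "\<omega> \<in> space M" "0 \<le> s" "s \<le> u" "N s \<omega> = N u \<omega>"
  shows "telegraph V0 N u \<omega> - telegraph V0 N s \<omega> = V0 \<omega> * (u - s) * (-1) ^ N u \<omega>"
proof -
  have "N v \<omega> = N u \<omega>" if "v \<in> {s..u}" for v
    using that assms mono_onD[OF mono_paths[OF assms(1)], of s v] mono_onD[OF mono_paths[OF assms(1)], of v u]
    by auto
  then have "integral {s..u} (\<lambda>s. V0 \<omega> * (-1) ^ N s \<omega>) = integral {s..u} (\<lambda>_. V0 \<omega> * (-1) ^ N u \<omega>)"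
    by (intro Henstock_Kurzweil_Integration.integral_cong) (simp only:)
  then show ?thesis
    using assms by (simp add: telegraph_diff)
qed

text \<open>A cell without a jump contributes no error. In a cell with a jump, the true increment
  and the walk step are each at most \<open>\<bar>V0 \<omega>\<bar> * \<delta>\<close> in modulus,
  and there are at most as many such cells as jumps.\<close>

lemma telegraph_grid_walk:
  assumes "\<omega> \<in> space M" "0 \<le> \<delta>"
  shows "\<bar>telegraph V0 N (real i * \<delta>) \<omega> - V0 \<omega> * \<delta> * of_int (grid_walk N \<delta> i \<omega>)\<bar>
    \<le> 2 * \<bar>V0 \<omega>\<bar> * \<delta> * real (N (real i * \<delta>) \<omega>)"
proof (induction i)
  case 0
  show ?case using assms(2) by (simp add: telegraph_def grid_walk_def)
next
  case (Suc i)
  define s u where "s = real i * \<delta>" and "u = real (Suc i) * \<delta>"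
  have su: "0 \<le> s" "s \<le> u" "u - s = \<delta>"
    using assms(2) by (auto simp: s_def u_def algebra_simps)
  have mono: "N s \<omega> \<le> N u \<omega>"
    using mono_onD[OF mono_paths[OF assms(1)], of s u] su by auto
  have "\<bar>telegraph V0 N u \<omega> - telegraph V0 N s \<omega> - V0 \<omega> * \<delta> * (-1) ^ N u \<omega>\<bar>
      \<le> 2 * \<bar>V0 \<omega>\<bar> * \<delta> * (real (N u \<omega>) - real (N s \<omega>))"
  proof (cases "N s \<omega> = N u \<omega>")
    case True
    then show ?thesis
      using telegraph_const_cell[OF assms(1) su(1,2)] su(3) by simp
  next
    case False
    have "\<bar>telegraph V0 N u \<omega> - telegraph V0 N s \<omega> - V0 \<omega> * \<delta> * (-1) ^ N u \<omega>\<bar>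
        \<le> \<bar>telegraph V0 N u \<omega> - telegraph V0 N s \<omega>\<bar> + \<bar>V0 \<omega> * \<delta> * (-1) ^ N u \<omega>\<bar>"
      by (rule abs_triangle_ineq4)
    also have "\<dots> \<le> \<bar>V0 \<omega>\<bar> * \<delta> + \<bar>V0 \<omega>\<bar> * \<delta>"
      using telegraph_lipschitz[OF assms(1) su(1,2)] su(3) assms(2)
      by (simp add: abs_mult power_abs mult.commute)
    also have "\<dots> = 2 * \<bar>V0 \<omega>\<bar> * \<delta> * 1" by simp
    also have "\<dots> \<le> 2 * \<bar>V0 \<omega>\<bar> * \<delta> * (real (N u \<omega>) - real (N s \<omega>))"
      using False mono assms(2) by (intro mult_left_mono) auto
    finally show ?thesis .
  qed
  moreover have "of_int (grid_walk N \<delta> (Suc i) \<omega>) = of_int (grid_walk N \<delta> i \<omega>) + (-1 :: real) ^ N u \<omega>"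
    by (simp add: grid_walk_def u_def)
  ultimately show ?case
    using Suc.IH unfolding s_def[symmetric] u_def[symmetric]
    by (simp add: algebra_simps)
qed

lemma telegraph_le_max:
  assumes "\<omega> \<in> space M" "u \<in> {0..t}"
  shows "telegraph V0 N u \<omega> \<le> telegraph_max V0 N t \<omega>"
  unfolding telegraph_max_def
proof (rule cSUP_upper[OF assms(2)])
  have "continuous_on {0..t} (\<lambda>s. telegraph V0 N s \<omega>)"
    unfolding telegraph_def
    by (rule indefinite_integral_continuous_1[OF telegraph_integrable[OF assms(1)]])
  then have "compact ((\<lambda>s. telegraph V0 N s \<omega>) ` {0..t})"
    by (rule compact_continuous_image) (rule compact_Icc)
  then show "bdd_above ((\<lambda>s. telegraph V0 N s \<omega>) ` {0..t})"
    by (intro bounded_imp_bdd_above compact_imp_bounded)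
qed

section \<open>The maximum over the grid\<close>

definition grid_max :: "real \<Rightarrow> nat \<Rightarrow> 'a \<Rightarrow> real" where
  "grid_max t m \<omega> = Max ((\<lambda>i. V0 \<omega> * (t / m) * of_int (grid_walk N (t / m) i \<omega>)) ` {..m})"

text \<open>Moving from a maximiser to the grid point on its left costs one cell, the summand 1 in
  the bound; passing between process and walk at a grid point costs at most two cells per
  jump.\<close>

lemma telegraph_max_grid:
  assumes \<omega>: "\<omega> \<in> space M" and t: "0 < t" and m: "0 < m"
  shows "\<bar>telegraph_max V0 N t \<omega> - grid_max t m \<omega>\<bar> \<le> \<bar>V0 \<omega>\<bar> * (t / m) * (2 * real (N t \<omega>) + 1)"
proof -
  define \<delta> where "\<delta> = t / m"
  have \<delta>: "0 < \<delta>" "real m * \<delta> = t"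
    using t m by (auto simp: \<delta>_def)
  let ?W = "\<lambda>i. V0 \<omega> * \<delta> * of_int (grid_walk N \<delta> i \<omega>)"
  have le_t: "real i * \<delta> \<le> t" if "i \<le> m" for i
    using that \<delta> by (metis mult_right_mono of_nat_le_iff less_imp_le)
  have grid: "\<bar>telegraph V0 N (real i * \<delta>) \<omega> - ?W i\<bar> \<le> 2 * \<bar>V0 \<omega>\<bar> * \<delta> * real (N t \<omega>)" if "i \<le> m" for i
  proof -
    have "N (real i * \<delta>) \<omega> \<le> N t \<omega>"
      using mono_onD[OF mono_paths[OF \<omega>], of "real i * \<delta>" t] le_t[OF that] \<delta> by auto
    then have "2 * \<bar>V0 \<omega>\<bar> * \<delta> * real (N (real i * \<delta>) \<omega>) \<le> 2 * \<bar>V0 \<omega>\<bar> * \<delta> * real (N t \<omega>)"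
      using \<delta> by (intro mult_left_mono) auto
    then show ?thesis
      using telegraph_grid_walk[OF \<omega>, of \<delta> i] \<delta> by linarith
  qed
  have gm: "grid_max t m \<omega> = Max (?W ` {..m})"
    by (simp add: grid_max_def \<delta>_def)
  obtain s where s: "s \<in> {0..t}" "telegraph_max V0 N t \<omega> = telegraph V0 N s \<omega>"
    using telegraph_max_attained[OF \<omega> less_imp_le[OF t]] by blast
  define i where "i = nat \<lfloor>s / \<delta>\<rfloor>"
  have i: "real i * \<delta> \<le> s" "s \<le> real i * \<delta> + \<delta>"
  proof -
    have "real i \<le> s / \<delta>" "s / \<delta> \<le> real i + 1"
      using s(1) \<delta>(1) by (auto simp: i_def)
    then show "real i * \<delta> \<le> s" "s \<le> real i * \<delta> + \<delta>"
      using \<delta>(1) by (auto simp: field_simps)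
  qed
  have im: "i \<le> m"
  proof -
    have "real i * \<delta> \<le> real m * \<delta>"
      using i(1) s(1) \<delta>(2) by auto
    then show ?thesis using \<delta>(1) by simp
  qed
  have "\<bar>telegraph V0 N s \<omega> - telegraph V0 N (real i * \<delta>) \<omega>\<bar> \<le> \<bar>V0 \<omega>\<bar> * (s - real i * \<delta>)"
    using i \<delta> by (intro telegraph_lipschitz \<omega>) auto
  also have "\<dots> \<le> \<bar>V0 \<omega>\<bar> * \<delta>"
    using i by (intro mult_left_mono) auto
  finally have "telegraph_max V0 N t \<omega> \<le> ?W i + \<bar>V0 \<omega>\<bar> * \<delta> * (2 * real (N t \<omega>) + 1)"
    using grid[OF im] s(2) by (simp add: algebra_simps abs_le_iff)
  moreover have "?W i \<le> grid_max t m \<omega>"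
    unfolding gm using im by (intro Max_ge) auto
  moreover have "Max (?W ` {..m}) \<in> ?W ` {..m}"
    by (rule Max_in) auto
  then obtain j where j: "j \<le> m" "grid_max t m \<omega> = ?W j"
    unfolding gm by blast
  moreover have "?W j \<le> telegraph_max V0 N t \<omega> + 2 * \<bar>V0 \<omega>\<bar> * \<delta> * real (N t \<omega>)"
    using grid[OF j(1)] telegraph_le_max[OF \<omega>, of "real j * \<delta>" t] le_t[OF j(1)] \<delta> by (simp add: abs_le_iff)
  moreover have "0 \<le> \<bar>V0 \<omega>\<bar> * \<delta>" using \<delta> by simp
  ultimately show ?thesis
    using j(2) unfolding \<delta>_def[symmetric] by (simp add: algebra_simps abs_le_iff)
qed

text \<open>The maximum is the pointwise limit of the grid maxima, which are finite maxima of
  measurable functions.\<close>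

lemma measurable_telegraph_max:
  assumes "0 < t"
  shows "telegraph_max V0 N t \<in> borel_measurable M"
proof (rule borel_measurable_LIMSEQ_metric)
  show "grid_max t (Suc m) \<in> borel_measurable M" for m
  proof -
    have "(\<lambda>\<omega>. real_of_int (grid_walk N (t / Suc m) i \<omega>)) \<in> borel_measurable M" for i
      using assms by (intro measurable_compose[OF measurable_grid_walk[OF rv_N]]) auto
    then show ?thesis
      unfolding grid_max_def[abs_def]
      by (intro borel_measurable_Max borel_measurable_times rv_V0 borel_measurable_const finite_atMost)
  qed
next
  fix \<omega> assume \<omega>: "\<omega> \<in> space M"
  have "(\<lambda>m. grid_max t (Suc m) \<omega> - telegraph_max V0 N t \<omega>) \<longlonglongrightarrow> 0"
  proof (rule Lim_null_comparison)
    have "norm (grid_max t (Suc m) \<omega> - telegraph_max V0 N t \<omega>) \<le>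
        \<bar>V0 \<omega>\<bar> * (t / real (Suc m)) * (2 * real (N t \<omega>) + 1)" for m
      using telegraph_max_grid[OF \<omega> assms, of "Suc m"]
      by (simp only: real_norm_def abs_minus_commute[of "grid_max t (Suc m) \<omega>"] zero_less_Suc simp_thms)
    then show "\<forall>\<^sub>F m in sequentially. norm (grid_max t (Suc m) \<omega> - telegraph_max V0 N t \<omega>) \<le>
        \<bar>V0 \<omega>\<bar> * (t / real (Suc m)) * (2 * real (N t \<omega>) + 1)"
      by (rule always_eventually[OF allI])
    have "(\<lambda>m. t / real (Suc m)) \<longlonglongrightarrow> 0"
      by (rule LIMSEQ_Suc[OF lim_const_over_n])
    then show "(\<lambda>m. \<bar>V0 \<omega>\<bar> * (t / real (Suc m)) * (2 * real (N t \<omega>) + 1)) \<longlonglongrightarrow> 0"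
      by (intro tendsto_mult_left_zero tendsto_mult_right_zero)
  qed
  then show "(\<lambda>m. grid_max t (Suc m) \<omega>) \<longlonglongrightarrow> telegraph_max V0 N t \<omega>"
    by (rule LIM_zero_cancel)
qed

end

subsection \<open>Probability of the discretised events\<close>

lemma count_list_take_True:
  "j \<le> length xs \<Longrightarrow> count_list (take j xs) True = (\<Sum>i<j. of_bool (xs ! i))"
  by (induction j) (auto simp: take_Suc_conv_app_nth)

context poisson_process
begin

text \<open>For lists of a fixed length these events are disjoint and together consist of the paths
  with at most one jump in every cell.\<close>

definition cell_event :: "real \<Rightarrow> bool list \<Rightarrow> 'a set" where
  "cell_event \<delta> xs = {\<omega> \<in> space M. \<forall>i<length xs.
    N (real (Suc i) * \<delta>) \<omega> = N (real i * \<delta>) \<omega> + of_bool (xs ! i)}"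

lemma cell_event_sets:
  assumes "0 \<le> \<delta>"
  shows "cell_event \<delta> xs \<in> events"
proof -
  have "{\<omega> \<in> space M. \<forall>i\<in>{..<length xs}.
      N (real (Suc i) * \<delta>) \<omega> = N (real i * \<delta>) \<omega> + of_bool (xs ! i)} \<in> events"
  proof (rule sets.sets_Collect_finite_All[OF _ finite_lessThan])
    fix i
    have "(\<lambda>\<omega>. real (N (real (Suc i) * \<delta>) \<omega>)) \<in> borel_measurable M"
      using assms by (intro measurable_compose[OF rv_N]) simp_all
    moreover have "(\<lambda>\<omega>. real (N (real i * \<delta>) \<omega> + of_bool (xs ! i))) \<in> borel_measurable M"
      using assms by (intro measurable_compose[OF rv_N, where g = "\<lambda>n. real (n + of_bool (xs ! i))"]) simp_all
    ultimately have "{\<omega> \<in> space M. real (N (real (Suc i) * \<delta>) \<omega>) = real (N (real i * \<delta>) \<omega> + of_bool (xs ! i))} \<in> events"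
      by (rule borel_measurable_eq)
    then show "{\<omega> \<in> space M. N (real (Suc i) * \<delta>) \<omega> = N (real i * \<delta>) \<omega> + of_bool (xs ! i)} \<in> events"
      by (simp only: of_nat_eq_iff)
  qed
  then show ?thesis
    by (simp only: cell_event_def Ball_def lessThan_iff)
qed

lemma cell_event_count:
  assumes "\<omega> \<in> cell_event \<delta> xs" "j \<le> length xs"
  shows "N (real j * \<delta>) \<omega> = count_list (take j xs) True"
  using assms(2)
proof (induction j)
  case 0
  show ?case using assms(1) N_zero by (simp add: cell_event_def)
next
  case (Suc j)
  then have "N (real (Suc j) * \<delta>) \<omega> = N (real j * \<delta>) \<omega> + of_bool (xs ! j)"
    using assms(1) by (auto simp: cell_event_def)
  with Suc show ?case
    by (simp add: count_list_take_True del: of_nat_Suc)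
qed

lemma prob_increment:
  assumes "0 \<le> s" "s < u"
  shows "prob {\<omega> \<in> space M. N u \<omega> - N s \<omega> = a} = (rate * (u - s)) ^ a / fact a * exp (- (rate * (u - s)))"
proof -
  have [measurable]: "N s \<in> measurable M (count_space UNIV)" "N u \<in> measurable M (count_space UNIV)"
    using rv_N assms by auto
  have "prob {\<omega> \<in> space M. N u \<omega> - N s \<omega> = a} = measure (distr M (count_space UNIV) (\<lambda>\<omega>. N u \<omega> - N s \<omega>)) {a}"
    by (subst measure_distr) (auto intro!: arg_cong[where f = prob])
  also have "\<dots> = pmf (poisson_pmf (rate * (u - s))) a"
    unfolding distr_increment[OF assms] by (simp add: pmf.rep_eq)
  also have "\<dots> = (rate * (u - s)) ^ a / fact a * exp (- (rate * (u - s)))"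
    using assms rate_pos by (intro pmf_poisson) simp
  finally show ?thesis .
qed

lemma prob_count:
  assumes "0 < t"
  shows "prob {\<omega> \<in> space M. N t \<omega> = n} = (rate * t) ^ n / fact n * exp (- (rate * t))"
proof -
  have "{\<omega> \<in> space M. N t \<omega> = n} = {\<omega> \<in> space M. N t \<omega> - N 0 \<omega> = n}"
    using N_zero by auto
  then show ?thesis
    using prob_increment[of 0 t n] assms by simp
qed

text \<open>By independence the probability is a product of Poisson weights at 0 or 1, whose
  factorials are 1. It depends only on the length and the number of set bits, so all placements of
  the jumps are equally likely.\<close>

lemma prob_cell_event:
  assumes "0 < \<delta>"
  shows "prob (cell_event \<delta> xs) =
    (rate * \<delta>) ^ count_list xs True * exp (- (rate * (real (length xs) * \<delta>)))"
proof (cases "xs = []")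
  case True
  then show ?thesis by (simp add: cell_event_def prob_space)
next
  case False
  define X where "X = (\<lambda>i \<omega>. N (real (Suc i) * \<delta>) \<omega> - N (real i * \<delta>) \<omega>)"
  have indep: "indep_vars (\<lambda>_. count_space UNIV) X {..<length xs}"
    unfolding X_def
    using assms by (intro indep_increments[of "\<lambda>i. real i * \<delta>"]) (auto simp: incseq_def)
  have nn: "0 \<le> real i * \<delta>" for i using assms by simp
  have le: "N (real i * \<delta>) \<omega> \<le> N (real (Suc i) * \<delta>) \<omega>" if "\<omega> \<in> space M" for i \<omega>
    using mono_onD[OF mono_paths[OF that], of "real i * \<delta>" "real (Suc i) * \<delta>"] nn[of i] nn[of "Suc i"] assms
    by (simp add: algebra_simps)
  have "cell_event \<delta> xs = (\<Inter>i\<in>{..<length xs}. X i -` {of_bool (xs ! i)} \<inter> space M)"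
  proof -
    \<comment> \<open>Monotone paths make the natural subtraction in \<open>X\<close> exact.\<close>
    have iff: "N (real (Suc i) * \<delta>) \<omega> = N (real i * \<delta>) \<omega> + of_bool (xs ! i) \<longleftrightarrow> X i \<omega> = of_bool (xs ! i)"
      if "\<omega> \<in> space M" for i \<omega>
      using le[OF that, of i] unfolding X_def by linarith
    have "cell_event \<delta> xs = {\<omega> \<in> space M. \<forall>i<length xs. X i \<omega> = of_bool (xs ! i)}"
      unfolding cell_event_def using iff by blast
    also have "\<dots> = (\<Inter>i\<in>{..<length xs}. X i -` {of_bool (xs ! i)} \<inter> space M)"
      using False by auto
    finally show ?thesis .
  qed
  moreover have "{..<length xs} \<noteq> {}" using False by auto
  ultimately have "prob (cell_event \<delta> xs) = (\<Prod>i<length xs. prob (X i -` {of_bool (xs ! i)} \<inter> space M))"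
    using indep_varsD_finite[OF indep _ finite_lessThan, where A = "\<lambda>i. {of_bool (xs ! i)}"]
    by (simp only: sets_count_space Pow_UNIV UNIV_I not_False_eq_True)
  also have "\<dots> = (\<Prod>i<length xs. (rate * \<delta>) ^ of_bool (xs ! i) * exp (- (rate * \<delta>)))"
  proof (rule prod.cong[OF refl])
    fix i
    have "X i -` {of_bool (xs ! i)} \<inter> space M =
        {\<omega> \<in> space M. N (real (Suc i) * \<delta>) \<omega> - N (real i * \<delta>) \<omega> = of_bool (xs ! i)}"
      unfolding X_def by blast
    moreover have "real i * \<delta> < real (Suc i) * \<delta>" "real (Suc i) * \<delta> - real i * \<delta> = \<delta>"
      using assms by (simp_all add: algebra_simps)
    moreover have "fact (of_bool (xs ! i)) = (1 :: real)"
      by (cases "xs ! i") simp_all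
    ultimately show "prob (X i -` {of_bool (xs ! i)} \<inter> space M) = (rate * \<delta>) ^ of_bool (xs ! i) * exp (- (rate * \<delta>))"
      using prob_increment[OF nn, of i "real (Suc i) * \<delta>" "of_bool (xs ! i)"] by (simp only: div_by_1)
  qed
  also have "\<dots> = (rate * \<delta>) ^ (\<Sum>i<length xs. of_bool (xs ! i)) * exp (- (rate * \<delta>)) ^ length xs"
    by (simp only: prod.distrib power_sum prod_constant card_lessThan)
  also have "\<dots> = (rate * \<delta>) ^ count_list xs True * exp (- (rate * (real (length xs) * \<delta>)))"
    using count_list_take_True[of "length xs" xs]
    by (simp add: exp_of_nat_mult[symmetric] mult_ac)
  finally show ?thesis .
qed

lemma prob_cell_events:
  assumes "0 < t" "0 < m" "S \<subseteq> {xs. length xs = m \<and> count_list xs True = n}"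
  shows "prob (\<Union>xs\<in>S. cell_event (t / m) xs) = real (card S) * ((rate * t / m) ^ n * exp (- (rate * t)))"
proof -
  have fin: "finite S"
    by (rule finite_subset[OF _ finite_lists_length_eq[of UNIV m]]) (use assms(3) in auto)
  have "disjoint_family_on (cell_event (t / m)) S"
    unfolding disjoint_family_on_def
  proof (intro ballI impI, rule ccontr)
    fix xs ys assume xy: "xs \<in> S" "ys \<in> S" "xs \<noteq> ys" "cell_event (t / m) xs \<inter> cell_event (t / m) ys \<noteq> {}"
    then obtain \<omega> where \<omega>: "\<omega> \<in> cell_event (t / m) xs" "\<omega> \<in> cell_event (t / m) ys" by auto
    have "length xs = m" "length ys = m" using xy assms(3) by auto
    moreover have "xs ! i = ys ! i" if "i < m" for i
    proof -
      have "N (real i * (t / m)) \<omega> + of_bool (xs ! i) = N (real i * (t / m)) \<omega> + of_bool (ys ! i)"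
        using \<omega> that \<open>length xs = m\<close> \<open>length ys = m\<close> by (auto simp: cell_event_def)
      then show ?thesis by (cases "xs ! i"; cases "ys ! i") simp_all
    qed
    ultimately have "xs = ys" by (simp add: nth_equalityI)
    with xy show False by simp
  qed
  then have "prob (\<Union>xs\<in>S. cell_event (t / m) xs) = (\<Sum>xs\<in>S. prob (cell_event (t / m) xs))"
    using assms cell_event_sets by (intro finite_measure_finite_Union fin) auto
  also have "\<dots> = (\<Sum>xs\<in>S. (rate * t / m) ^ n * exp (- (rate * t)))"
  proof (rule sum.cong[OF refl])
    fix xs assume "xs \<in> S"
    then have "length xs = m" "count_list xs True = n" using assms(3) by auto
    then show "prob (cell_event (t / m) xs) = (rate * t / m) ^ n * exp (- (rate * t))"
      using assms(1,2) by (simp add: prob_cell_event)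
  qed
  finally show ?thesis by simp
qed

section \<open>The event that the grid walk reaches a level\<close>

definition hit_event :: "real \<Rightarrow> nat \<Rightarrow> nat \<Rightarrow> int \<Rightarrow> 'a set" where
  "hit_event t n m h = {\<omega> \<in> space M. N t \<omega> = n \<and> (\<exists>i\<le>m. h \<le> grid_walk N (t / m) i \<omega>)}"

lemma hit_event_sets:
  assumes "0 < t"
  shows "hit_event t n m h \<in> events"
proof -
  have [measurable]: "N t \<in> measurable M (count_space UNIV)"
    "grid_walk N (t / m) i \<in> measurable M (count_space UNIV)" for i
    using rv_N assms by (auto intro!: measurable_grid_walk)
  show ?thesis
    unfolding hit_event_def by measurable
qed

lemma cell_event_grid_walk:
  assumes "\<omega> \<in> cell_event \<delta> xs" "i \<le> length xs"
  shows "grid_walk N \<delta> i \<omega> = (\<Sum>j<i. 1 * (-1) ^ count_list (take (Suc j) xs) True)"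
  unfolding grid_walk_def
  using assms by (intro sum.cong) (auto simp: cell_event_count simp del: of_nat_Suc)

lemma cell_event_subset_hit_event:
  assumes "0 < m" "xs \<in> reaching 1 h m n"
  shows "cell_event (t / m) xs \<subseteq> hit_event t n m h"
proof
  fix \<omega> assume \<omega>: "\<omega> \<in> cell_event (t / m) xs"
  have xs: "length xs = m" "count_list xs True = n" "reaches 1 h xs"
    using assms(2) by (auto simp: reaching_def)
  have "N t \<omega> = n"
    using cell_event_count[OF \<omega>, of m] xs assms(1) by simp
  moreover have "\<exists>i\<le>m. h \<le> grid_walk N (t / m) i \<omega>"
    using xs(1,3) cell_event_grid_walk[OF \<omega>] by (auto simp: reaches_iff)
  ultimately show "\<omega> \<in> hit_event t n m h"
    using \<omega> by (auto simp: hit_event_def cell_event_def)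
qed

text \<open>The error is the probability that some cell contains at least two jumps.\<close>

lemma prob_hit_event_approx:
  fixes n m :: nat
  assumes "0 < t" "0 < m"
  defines "q \<equiv> (rate * t / m) ^ n * exp (- (rate * t))"
  shows "\<bar>prob (hit_event t n m h) - real (card (reaching 1 h m n)) * q\<bar> \<le>
    prob {\<omega> \<in> space M. N t \<omega> = n} - real (m choose n) * q"
proof -
  let ?U = "\<lambda>h. \<Union>xs\<in>reaching 1 h m n. cell_event (t / m) xs"
  have U: "prob (?U h) = real (card (reaching 1 h m n)) * q" for h
    unfolding q_def by (rule prob_cell_events[OF assms(1,2)]) (auto simp: reaching_def)
  have sets: "?U h \<in> events" for h
    using assms(1,2) cell_event_sets by (intro sets.finite_UN) auto
  have sub: "?U h \<subseteq> hit_event t n m h" for h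
    using cell_event_subset_hit_event[OF assms(2)] by blast
  have all: "hit_event t n m 0 = {\<omega> \<in> space M. N t \<omega> = n}"
    by (auto simp: hit_event_def grid_walk_def intro!: exI[of _ 0])
  \<comment> \<open>Level 0 is always reached, so the right-hand side consists of the paths with
    \<open>n\<close> jumps in no cell event. On a cell event the bits determine the walk, so nothing
    is lost there at any level; hence the error bound does not depend on \<open>h\<close>.\<close>
  have "hit_event t n m h - ?U h \<subseteq> hit_event t n m 0 - ?U 0"
  proof -
    have "hit_event t n m h \<subseteq> hit_event t n m 0"
      unfolding all by (auto simp: hit_event_def)
    moreover have "\<omega> \<in> ?U h" if \<omega>: "\<omega> \<in> hit_event t n m h"
      and xs: "xs \<in> reaching 1 0 m n" "\<omega> \<in> cell_event (t / m) xs" for \<omega> xs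
    proof -
      obtain i where "i \<le> m" "h \<le> grid_walk N (t / m) i \<omega>"
        using \<omega> by (auto simp: hit_event_def)
      then have "reaches 1 h xs"
        using cell_event_grid_walk[OF xs(2), of i] xs(1) unfolding reaches_iff by (auto simp: reaching_def)
      then show ?thesis
        using xs by (auto simp: reaching_def)
    qed
    ultimately show ?thesis by blast
  qed
  then have "prob (hit_event t n m h - ?U h) \<le> prob (hit_event t n m 0 - ?U 0)"
    using sets hit_event_sets[OF assms(1)] by (intro finite_measure_mono) auto
  then have "prob (hit_event t n m h) - prob (?U h) \<le> prob (hit_event t n m 0) - prob (?U 0)"
    using sets sub hit_event_sets[OF assms(1)] by (simp add: finite_measure_Diff)
  moreover have "prob (?U h) \<le> prob (hit_event t n m h)"
    using sub hit_event_sets[OF assms(1)] by (intro finite_measure_mono)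
  ultimately show ?thesis
    unfolding U all by (simp add: card_reaching_nonpos)
qed

text \<open>With \<open>b m\<close> down steps and \<open>m - b m\<close> up steps, the level has
  the form \<open>a - b\<close> with \<open>a + b = m\<close> that \<open>card_reaching\<close>
  demands, and it is close to \<open>z * m\<close>.\<close>

lemma tendsto_prob_hit_event:
  assumes t: "0 < t" and z: "0 \<le> z" "z \<le> 1"
  defines "b \<equiv> \<lambda>m. nat \<lfloor>(1 - z) / 2 * real m\<rfloor>"
  shows "(\<lambda>m. prob (hit_event t n m (int m - 2 * int (b m)))) \<longlonglongrightarrow>
      prob {\<omega> \<in> space M. N t \<omega> = n} * max_survival n z" (is ?lim)
    and "(\<lambda>m. real_of_int (int m - 2 * int (b m)) / real m) \<longlonglongrightarrow> z" (is ?height)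
proof -
  have b: "real (b m) \<le> (1 - z) / 2 * real m" "(1 - z) / 2 * real m - 1 \<le> real (b m)" for m
  proof -
    have "0 \<le> (1 - z) / 2 * real m" using z by simp
    then have "real (b m) = real_of_int \<lfloor>(1 - z) / 2 * real m\<rfloor>"
      unfolding b_def by simp
    then show "real (b m) \<le> (1 - z) / 2 * real m" "(1 - z) / 2 * real m - 1 \<le> real (b m)"
      by linarith+
  qed
  have b_half: "2 * b m \<le> m" for m
  proof -
    have "(1 - z) / 2 * real m \<le> 1 / 2 * real m"
      using z by (intro mult_right_mono) auto
    then have "real (2 * b m) \<le> real m" using b(1)[of m] by simp
    then show ?thesis by linarith
  qed
  have lim_b: "(\<lambda>m. real (b m) / real m) \<longlonglongrightarrow> (1 - z) / 2"
  proof (rule tendsto_sandwich)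
    show "\<forall>\<^sub>F m in sequentially. (1 - z) / 2 - 1 / real m \<le> real (b m) / real m"
      using eventually_gt_at_top[of 0] proof eventually_elim
      fix m :: nat assume "0 < m"
      then show "(1 - z) / 2 - 1 / real m \<le> real (b m) / real m"
        using divide_right_mono[OF b(2)[of m], of "real m"] by (simp add: diff_divide_distrib)
    qed
    show "\<forall>\<^sub>F m in sequentially. real (b m) / real m \<le> (1 - z) / 2"
      using eventually_gt_at_top[of 0] by eventually_elim (use b(1) in \<open>simp add: field_simps\<close>)
    show "(\<lambda>m. (1 - z) / 2 - 1 / real m) \<longlonglongrightarrow> (1 - z) / 2"
      using tendsto_diff[OF tendsto_const lim_const_over_n, of "(1 - z) / 2" 1] by simp
  qed simp
  have lim_1: "(\<lambda>m. real m / real m) \<longlonglongrightarrow> 1"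
    by (rule tendsto_eventually) (use eventually_gt_at_top[of 0] in \<open>eventually_elim, simp\<close>)
  have "(\<lambda>m. real m / real m - 2 * (real (b m) / real m)) \<longlonglongrightarrow> 1 - 2 * ((1 - z) / 2)"
    by (intro tendsto_diff tendsto_mult tendsto_const lim_b lim_1)
  then show ?height
    by (simp add: diff_divide_distrib)
  have lim_a: "(\<lambda>m. real (m - b m) / real m) \<longlonglongrightarrow> (1 + z) / 2"
  proof -
    have "(\<lambda>m. real m / real m - real (b m) / real m) \<longlonglongrightarrow> 1 - (1 - z) / 2"
      by (intro tendsto_diff lim_b lim_1)
    moreover have "real m / real m - real (b m) / real m = real (m - b m) / real m" for m
      using b_half[of m] by (simp add: of_nat_diff diff_divide_distrib)
    moreover have "1 - (1 - z) / 2 = (1 + z) / 2" by (simp add: field_simps)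
    ultimately show ?thesis by simp
  qed
  define K where "K = (rate * t) ^ n * exp (- (rate * t))"
  define q where "q = (\<lambda>m. (rate * t / real m) ^ n * exp (- (rate * t)))"
  have q: "x * q m = K * (x / real m ^ n)" for x m
    by (simp add: q_def K_def power_divide)
  define h where "h = (\<lambda>m. int m - 2 * int (b m))"
  have card: "card (reaching 1 (h m) m n) = reach_count n (m - b m) (b m)" for m
    using card_reaching(1)[of "b m" "m - b m" n] b_half[of m] by (simp add: h_def of_nat_diff)
  have pN: "prob {\<omega> \<in> space M. N t \<omega> = n} = K / fact n"
    using prob_count[OF t, of n] by (simp add: K_def)
  have main: "(\<lambda>m. real (card (reaching 1 (h m) m n)) * q m) \<longlonglongrightarrow> K * reach_poly n ((1 + z) / 2) ((1 - z) / 2)"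
    unfolding card q by (intro tendsto_mult tendsto_const tendsto_reach_count lim_a lim_b)
  \<comment> \<open>The paths with one jump at most per cell exhaust the event
    \<open>N t = n\<close> in the limit.\<close>
  have "(\<lambda>m. K / fact n - real (m choose n) * q m) \<longlonglongrightarrow> K / fact n - K * (1 ^ n / fact n)"
    unfolding q by (intro tendsto_diff tendsto_mult tendsto_const tendsto_binomial_scaled lim_1)
  then have err: "(\<lambda>m. K / fact n - real (m choose n) * q m) \<longlonglongrightarrow> 0"
    by simp
  have "(\<lambda>m. prob (hit_event t n m (h m)) - real (card (reaching 1 (h m) m n)) * q m) \<longlonglongrightarrow> 0"
  proof (rule Lim_null_comparison[OF _ err])
    show "\<forall>\<^sub>F m in sequentially. norm (prob (hit_event t n m (h m)) - real (card (reaching 1 (h m) m n)) * q m)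
        \<le> K / fact n - real (m choose n) * q m"
      using eventually_gt_at_top[of 0]
      by eventually_elim (use prob_hit_event_approx[OF t, where n = n] in \<open>simp add: pN q_def\<close>)
  qed
  from tendsto_add[OF this main] show ?lim
    by (simp add: h_def pN max_survival_def)
qed

end

subsection \<open>The law of the maximum\<close>

context symmetric_telegraph
begin

text \<open>The hit event involves only finitely many values of the Poisson path, so it lies in the
  sigma-algebra of which \<open>V0\<close> is independent.\<close>

lemma prob_velocity_hit_event:
  assumes "0 < t"
  shows "prob ({\<omega> \<in> space M. V0 \<omega> = c} \<inter> hit_event t n m h) = prob (hit_event t n m h) / 2"
proof -
  define A where "A = vimage_algebra (space M) (\<lambda>\<omega>. \<lambda>t\<in>{0..}. N t \<omega>) (\<Pi>\<^sub>M t\<in>{0::real..}. count_space (UNIV :: nat set))"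
  have path: "(\<lambda>\<omega>. \<lambda>t\<in>{0..}. N t \<omega>) \<in> measurable A (\<Pi>\<^sub>M t\<in>{0..}. count_space UNIV)"
    unfolding A_def by (rule measurable_vimage_algebra1) (auto simp: space_PiM)
  have N: "N s \<in> measurable A (count_space UNIV)" if "0 \<le> s" for s
    using measurable_compose[OF path measurable_component_singleton[of s]] that by simp
  have [measurable]: "N t \<in> measurable A (count_space UNIV)"
    "grid_walk N (t / m) i \<in> measurable A (count_space UNIV)" for i
    using N assms by (auto intro!: measurable_grid_walk)
  have "{\<omega> \<in> space A. N t \<omega> = n \<and> (\<exists>i\<le>m. h \<le> grid_walk N (t / m) i \<omega>)} \<in> sets A"
    by measurable
  then have hit: "hit_event t n m h \<in> sets A"
    by (simp add: hit_event_def A_def)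
  have "V0 -` {c} \<inter> space M \<in> sets (vimage_algebra (space M) V0 borel)"
    by (rule in_vimage_algebra) simp
  moreover have "V0 -` {c} \<inter> space M = {\<omega> \<in> space M. V0 \<omega> = c}" by auto
  ultimately have "prob ({\<omega> \<in> space M. V0 \<omega> = c} \<inter> hit_event t n m h) =
      prob {\<omega> \<in> space M. V0 \<omega> = c} * prob (hit_event t n m h)"
    using indep_setD[OF indep_V0_N] hit unfolding A_def by simp
  then show ?thesis by (simp add: prob_V0_pos)
qed

lemma prob_velocity_count:
  assumes "0 < t"
  shows "prob {\<omega> \<in> space M. V0 \<omega> = c \<and> N t \<omega> = n} = prob {\<omega> \<in> space M. N t \<omega> = n} / 2"
proof -
  \<comment> \<open>With no steps and level 0 the hitting condition is vacuous.\<close>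
  have hit: "hit_event t n 0 0 = {\<omega> \<in> space M. N t \<omega> = n}"
    by (auto simp: hit_event_def grid_walk_def)
  have "{\<omega> \<in> space M. V0 \<omega> = c \<and> N t \<omega> = n} = {\<omega> \<in> space M. V0 \<omega> = c} \<inter> hit_event t n 0 0"
    unfolding hit by auto
  then show ?thesis
    using prob_velocity_hit_event[OF assms, of n 0 0] by (simp only: hit)
qed

section \<open>Tail probabilities of the maximum\<close>

definition tail_event :: "real \<Rightarrow> nat \<Rightarrow> real \<Rightarrow> 'a set" where
  "tail_event t n z = {\<omega> \<in> space M. V0 \<omega> = c \<and> N t \<omega> = n \<and> z * (c * t) < telegraph_max V0 N t \<omega>}"

lemma tail_event_sets:
  assumes "0 < t"
  shows "tail_event t n z \<in> events"
proof -
  have [measurable]: "N t \<in> measurable M (count_space UNIV)" "telegraph_max V0 N t \<in> borel_measurable M"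
    "V0 \<in> borel_measurable M"
    using rv_N assms measurable_telegraph_max rv_V0 by auto
  show ?thesis
    unfolding tail_event_def by measurable
qed

lemma grid_max_less_iff:
  assumes "V0 \<omega> = c" "0 < m"
  shows "y < grid_max t m \<omega> \<longleftrightarrow> (\<exists>i\<le>m. y < c * t * (of_int (grid_walk N (t / m) i \<omega>) / m))"
proof -
  have "y < grid_max t m \<omega> \<longleftrightarrow> (\<exists>i\<le>m. y < V0 \<omega> * (t / m) * of_int (grid_walk N (t / m) i \<omega>))"
    unfolding grid_max_def by (subst Max_gr_iff) auto
  then show ?thesis
    using assms(1) by simp
qed

text \<open>On \<open>N t = n\<close> with velocity \<open>c\<close>, \<open>(2 * n + 1) / m\<close>
  is the grid error in units of \<open>c * t\<close>; lowering the level by it passes from the true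
  maximum to the walk.\<close>

lemma tail_event_subset_hit_event:
  assumes "0 < t" "0 < m" "of_int h / real m + (2 * real n + 1) / real m \<le> z"
  shows "tail_event t n z \<subseteq> {\<omega> \<in> space M. V0 \<omega> = c} \<inter> hit_event t n m h"
proof
  fix \<omega> assume "\<omega> \<in> tail_event t n z"
  then have \<omega>: "\<omega> \<in> space M" "V0 \<omega> = c" "N t \<omega> = n" "z * (c * t) < telegraph_max V0 N t \<omega>"
    by (auto simp: tail_event_def)
  have ct: "0 < c * t" using assms(1) speed_pos by simp
  have "telegraph_max V0 N t \<omega> \<le> grid_max t m \<omega> + c * t * ((2 * real n + 1) / m)"
    using telegraph_max_grid[OF \<omega>(1) assms(1,2)] \<omega>(2,3) speed_pos by (simp add: abs_le_iff)
  moreover have "c * t * (of_int h / real m + (2 * real n + 1) / real m) \<le> c * t * z"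
    using assms(3) ct by (intro mult_left_mono) auto
  ultimately have "c * t * (of_int h / real m) < grid_max t m \<omega>"
    using \<omega>(4) by (simp only: distrib_left mult.commute[of z])
  then obtain i where "i \<le> m" "c * t * (of_int h / real m) < c * t * (of_int (grid_walk N (t / m) i \<omega>) / m)"
    using grid_max_less_iff[OF \<omega>(2) assms(2)] by blast
  then have "i \<le> m" "h \<le> grid_walk N (t / m) i \<omega>"
    using ct assms(2) by (simp_all add: mult_less_cancel_left_pos divide_less_cancel)
  then show "\<omega> \<in> {\<omega> \<in> space M. V0 \<omega> = c} \<inter> hit_event t n m h"
    using \<omega> by (auto simp: hit_event_def)
qed

lemma hit_event_subset_tail_event:
  assumes "0 < t" "0 < m" "z < of_int h / real m - (2 * real n + 1) / real m"
  shows "{\<omega> \<in> space M. V0 \<omega> = c} \<inter> hit_event t n m h \<subseteq> tail_event t n z"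
proof
  fix \<omega> assume "\<omega> \<in> {\<omega> \<in> space M. V0 \<omega> = c} \<inter> hit_event t n m h"
  then obtain i where \<omega>: "\<omega> \<in> space M" "V0 \<omega> = c" "N t \<omega> = n"
    and i: "i \<le> m" "h \<le> grid_walk N (t / m) i \<omega>"
    by (auto simp: hit_event_def)
  have ct: "0 < c * t" using assms(1) speed_pos by simp
  have "z + (2 * real n + 1) / real m < of_int (grid_walk N (t / m) i \<omega>) / m"
  proof -
    have "of_int h / real m \<le> of_int (grid_walk N (t / m) i \<omega>) / real m"
      using i by (intro divide_right_mono) auto
    then show ?thesis using assms(3) by linarith
  qed
  then have "c * t * (z + (2 * real n + 1) / real m) < c * t * (of_int (grid_walk N (t / m) i \<omega>) / m)"
    using ct by (rule mult_strict_left_mono)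
  then have "c * t * (z + (2 * real n + 1) / real m) < grid_max t m \<omega>"
    using grid_max_less_iff[OF \<omega>(2) assms(2)] i(1) by blast
  moreover have "grid_max t m \<omega> \<le> telegraph_max V0 N t \<omega> + c * t * ((2 * real n + 1) / m)"
    using telegraph_max_grid[OF \<omega>(1) assms(1,2)] \<omega>(2,3) speed_pos by (simp add: abs_le_iff)
  ultimately have "z * (c * t) < telegraph_max V0 N t \<omega>"
    by (simp only: distrib_left mult.commute[of z])
  then show "\<omega> \<in> tail_event t n z"
    using \<omega> by (simp add: tail_event_def)
qed

text \<open>For large \<open>m\<close> the gap between \<open>z\<close> and \<open>z'\<close>
  exceeds the grid error, so tail and hit events are nested, and the bounds survive the
  limit.\<close>

lemma prob_tail_event_bounds:
  fixes n :: nat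
  assumes t: "0 < t" and z: "0 \<le> z" "z < z'" "z' \<le> 1"
  defines "p \<equiv> prob {\<omega> \<in> space M. V0 \<omega> = c \<and> N t \<omega> = n}"
  shows "prob (tail_event t n z') \<le> p * max_survival n z"
    and "p * max_survival n z' \<le> prob (tail_event t n z)"
proof -
  define h where "h = (\<lambda>y m. int m - 2 * int (nat \<lfloor>(1 - y) / 2 * real m\<rfloor>))"
  have lim: "(\<lambda>m. prob ({\<omega> \<in> space M. V0 \<omega> = c} \<inter> hit_event t n m (h y m))) \<longlonglongrightarrow> p * max_survival n y"
    and height: "(\<lambda>m. of_int (h y m) / real m) \<longlonglongrightarrow> y" if "0 \<le> y" "y \<le> 1" for y
  proof -
    show "(\<lambda>m. of_int (h y m) / real m) \<longlonglongrightarrow> y"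
      unfolding h_def by (rule tendsto_prob_hit_event(2)[OF t that])
    have "(\<lambda>m. prob (hit_event t n m (h y m)) / 2) \<longlonglongrightarrow> prob {\<omega> \<in> space M. N t \<omega> = n} * max_survival n y / 2"
      unfolding h_def by (intro tendsto_divide tendsto_prob_hit_event(1)[OF t that] tendsto_const) simp
    then show "(\<lambda>m. prob ({\<omega> \<in> space M. V0 \<omega> = c} \<inter> hit_event t n m (h y m))) \<longlonglongrightarrow> p * max_survival n y"
      by (simp add: prob_velocity_hit_event[OF t] p_def prob_velocity_count[OF t])
  qed
  have err: "(\<lambda>m. (2 * real n + 1) / real m) \<longlonglongrightarrow> 0"
    by (rule lim_const_over_n)
  have ev: "{\<omega> \<in> space M. V0 \<omega> = c} \<inter> hit_event t n m h \<in> events" for m h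
    using hit_event_sets[OF t] rv_V0 by (intro sets.Int) auto
  have "\<forall>\<^sub>F m in sequentially. of_int (h z m) / real m + (2 * real n + 1) / real m < z'"
    using order_tendstoD(2)[OF tendsto_add[OF height err], of z z'] z by simp
  then have "\<forall>\<^sub>F m in sequentially. prob (tail_event t n z') \<le>
      prob ({\<omega> \<in> space M. V0 \<omega> = c} \<inter> hit_event t n m (h z m))"
    using eventually_gt_at_top[of 0]
  proof eventually_elim
    case (elim m)
    then show ?case
      by (intro finite_measure_mono ev tail_event_subset_hit_event[OF t]) auto
  qed
  then show "prob (tail_event t n z') \<le> p * max_survival n z"
    using tendsto_lowerbound[OF lim] z by simp
  have "\<forall>\<^sub>F m in sequentially. z < of_int (h z' m) / real m - (2 * real n + 1) / real m"
    using order_tendstoD(1)[OF tendsto_diff[OF height err], of z' z] z by simp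
  then have "\<forall>\<^sub>F m in sequentially. prob ({\<omega> \<in> space M. V0 \<omega> = c} \<inter> hit_event t n m (h z' m)) \<le>
      prob (tail_event t n z)"
    using eventually_gt_at_top[of 0]
  proof eventually_elim
    case (elim m)
    then show ?case
      by (intro finite_measure_mono tail_event_sets[OF t] hit_event_subset_tail_event[OF t]) auto
  qed
  then show "p * max_survival n z' \<le> prob (tail_event t n z)"
    using tendsto_upperbound[OF lim] z by simp
qed

text \<open>The other level tends to \<open>z\<close> from the left for the upper bound and from the
  right for the lower one.\<close>

lemma prob_tail_event:
  assumes t: "0 < t" and z: "0 < z" "z < 1" and cont: "isCont (max_survival n) z"
  shows "prob (tail_event t n z) = prob {\<omega> \<in> space M. V0 \<omega> = c \<and> N t \<omega> = n} * max_survival n z"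
    (is "_ = ?p * _")
proof (rule antisym)
  have lim: "((\<lambda>y. ?p * max_survival n y) \<longlongrightarrow> ?p * max_survival n z) (at z within S)" for S
    using cont by (intro tendsto_mult tendsto_const) (auto simp: isCont_def intro: tendsto_within_subset)
  show "prob (tail_event t n z) \<le> ?p * max_survival n z"
  proof (rule tendsto_lowerbound[OF lim])
    show "\<forall>\<^sub>F y in at_left z. prob (tail_event t n z) \<le> ?p * max_survival n y"
      using eventually_at_left[of 0 z] z by (auto intro!: exI[of _ 0] prob_tail_event_bounds(1)[OF t])
  qed simp
  show "?p * max_survival n z \<le> prob (tail_event t n z)"
  proof (rule tendsto_upperbound[OF lim])
    show "\<forall>\<^sub>F y in at_right z. ?p * max_survival n y \<le> prob (tail_event t n z)"
      using eventually_at_right[of z 1] z by (auto intro!: exI[of _ 1] prob_tail_event_bounds(2)[OF t])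
  qed simp
qed

lemma telegraph_max_le:
  assumes "\<omega> \<in> space M" "V0 \<omega> = c" "0 < t"
  shows "telegraph_max V0 N t \<omega> \<le> c * t"
proof -
  obtain s where s: "s \<in> {0..t}" "telegraph_max V0 N t \<omega> = telegraph V0 N s \<omega>"
    using telegraph_max_attained[OF assms(1) less_imp_le[OF assms(3)]] by blast
  have "telegraph V0 N s \<omega> \<le> c * s"
  proof -
    have "telegraph V0 N 0 \<omega> = 0" by (simp add: telegraph_def)
    then show ?thesis
      using telegraph_lipschitz[OF assms(1), of 0 s] s(1) assms(2) speed_pos by (simp add: abs_le_iff)
  qed
  also have "\<dots> \<le> c * t"
    using s(1) speed_pos by (intro mult_left_mono) auto
  finally show ?thesis using s(2) by simp
qed

lemma telegraph_max_no_switch: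
  assumes "\<omega> \<in> space M" "V0 \<omega> = c" "N t \<omega> = 0" "0 < t"
  shows "telegraph_max V0 N t \<omega> = c * t"
proof (rule antisym[OF telegraph_max_le[OF assms(1,2,4)]])
  have "N 0 \<omega> = N t \<omega>" using N_zero assms by simp
  from telegraph_const_cell[OF assms(1) order_refl less_imp_le[OF assms(4)] this]
  have "telegraph V0 N t \<omega> = c * t"
    using assms by (simp add: telegraph_def)
  moreover have "telegraph V0 N t \<omega> \<le> telegraph_max V0 N t \<omega>"
    by (rule telegraph_le_max) (use assms in auto)
  ultimately show "c * t \<le> telegraph_max V0 N t \<omega>" by simp
qed


section \<open>The distribution function and the density\<close>

lemma prob_max_le:
  assumes t: "0 < t" and n: "n \<in> {2 * k + 2, 2 * k + 1}"
  defines "A \<equiv> {\<omega> \<in> space M. V0 \<omega> = c \<and> N t \<omega> = n}"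
  shows "prob (A \<inter> {\<omega> \<in> space M. telegraph_max V0 N t \<omega> \<le> a}) =
    prob A * (1 - max_survival n (max 0 (min a (c * t)) / (c * t)))"
proof -
  have [measurable]: "N t \<in> measurable M (count_space UNIV)" "telegraph_max V0 N t \<in> borel_measurable M"
    "V0 \<in> borel_measurable M"
    using rv_N t measurable_telegraph_max rv_V0 by auto
  have A: "A \<in> events" unfolding A_def by measurable
  have B: "A \<inter> {\<omega> \<in> space M. telegraph_max V0 N t \<omega> \<le> a} \<in> events" for a
    unfolding A_def by measurable
  have ct: "0 < c * t" using t speed_pos by simp
  have cont: "isCont (max_survival n) z" for z
    using DERIV_isCont[OF DERIV_max_survival[OF n]] .
  have inner: "prob (A \<inter> {\<omega> \<in> space M. telegraph_max V0 N t \<omega> \<le> z * (c * t)}) = prob A * (1 - max_survival n z)"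
    if "0 < z" "z < 1" for z
  proof -
    have "A \<inter> {\<omega> \<in> space M. telegraph_max V0 N t \<omega> \<le> z * (c * t)} = A - tail_event t n z"
      unfolding A_def tail_event_def by auto
    moreover have "tail_event t n z \<subseteq> A"
      unfolding A_def tail_event_def by auto
    ultimately show ?thesis
      using prob_tail_event[OF t that cont] A tail_event_sets[OF t]
      by (simp add: finite_measure_Diff A_def right_diff_distrib)
  qed
  consider "a \<le> 0" | "0 < a" "a < c * t" | "c * t \<le> a" by linarith
  then show ?thesis
  proof cases
    case 1
    \<comment> \<open>Monotonicity bounds the probability by its values at small positive levels,
      which tend to 0 because \<open>max_survival n 0 = 1\<close>. So the maximum has no atom at
      0.\<close>
    have "((\<lambda>z. prob A * (1 - max_survival n z)) \<longlongrightarrow> prob A * (1 - max_survival n 0)) (at_right 0)"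
      using cont[of 0] by (intro tendsto_intros) (auto simp: isCont_def intro: tendsto_within_subset)
    moreover have "\<forall>\<^sub>F z in at_right 0. prob (A \<inter> {\<omega> \<in> space M. telegraph_max V0 N t \<omega> \<le> a}) \<le>
        prob A * (1 - max_survival n z)"
    proof (rule eventually_at_rightI[of 0 1])
      fix z :: real assume z: "z \<in> {0<..<1}"
      then have "0 < z * (c * t)" using ct by simp
      then have "prob (A \<inter> {\<omega> \<in> space M. telegraph_max V0 N t \<omega> \<le> a}) \<le>
          prob (A \<inter> {\<omega> \<in> space M. telegraph_max V0 N t \<omega> \<le> z * (c * t)})"
        using 1 by (intro finite_measure_mono B) auto
      then show "prob (A \<inter> {\<omega> \<in> space M. telegraph_max V0 N t \<omega> \<le> a}) \<le> prob A * (1 - max_survival n z)"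
        using inner z by simp
    qed simp
    ultimately have "prob (A \<inter> {\<omega> \<in> space M. telegraph_max V0 N t \<omega> \<le> a}) \<le> prob A * (1 - max_survival n 0)"
      by (rule tendsto_lowerbound) simp
    then have "prob (A \<inter> {\<omega> \<in> space M. telegraph_max V0 N t \<omega> \<le> a}) = 0"
      using measure_nonneg[of M "A \<inter> {\<omega> \<in> space M. telegraph_max V0 N t \<omega> \<le> a}"]
      by (simp add: max_survival_0)
    then show ?thesis
      using 1 ct by (simp add: max_survival_0 min_def max_def)
  next
    case 2
    then show ?thesis
      using inner[of "a / (c * t)"] ct t speed_pos by (simp add: min_def max_def)
  next
    case 3
    have "A \<inter> {\<omega> \<in> space M. telegraph_max V0 N t \<omega> \<le> a} = A"
      using telegraph_max_le[OF _ _ t] 3 by (force simp: A_def)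
    moreover have "0 < n" using n by auto
    ultimately show ?thesis
      using 3 ct t speed_pos by (simp add: max_survival_1 min_def max_def)
  qed
qed

lemma telegraph_max_has_cond_density:
  assumes t: "0 < t" and n: "n \<in> {2 * k + 2, 2 * k + 1}"
  shows "has_cond_density_on M (telegraph_max V0 N t)
    {\<omega> \<in> space M. V0 \<omega> = c \<and> N t \<omega> = n} {0<..<c * t}
    (\<lambda>\<beta>. 2 * (fact (2 * k + 1) / (fact k)\<^sup>2) *
      ((c\<^sup>2 * t\<^sup>2 - \<beta>\<^sup>2) ^ k / (2 * c * t) ^ (2 * k + 1)))"
proof -
  define d where "d = c * t"
  define X where "X = telegraph_max V0 N t"
  define A where "A = {\<omega> \<in> space M. V0 \<omega> = c \<and> N t \<omega> = n}"
  define f where "f = (\<lambda>\<beta>. 2 * (fact (2 * k + 1) / (fact k)\<^sup>2) *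
      ((c\<^sup>2 * t\<^sup>2 - \<beta>\<^sup>2) ^ k / (2 * c * t) ^ (2 * k + 1)) :: real)"
  define U where "U = uniform_measure M A"
  have d: "0 < d" using t speed_pos by (simp add: d_def)
  have X[measurable]: "X \<in> borel_measurable M"
    unfolding X_def by (rule measurable_telegraph_max[OF t])
  have [measurable]: "N t \<in> measurable M (count_space UNIV)" "V0 \<in> borel_measurable M"
    using rv_N t rv_V0 by auto
  have A[measurable]: "A \<in> events" unfolding A_def by measurable
  have f_borel[measurable]: "f \<in> borel_measurable borel"
    unfolding f_def by measurable
  have f_nonneg: "0 \<le> f x" if "x \<in> {0..d}" for x
  proof -
    have "x\<^sup>2 \<le> (c * t)\<^sup>2"
      using that by (intro power_mono) (auto simp: d_def)
    then show ?thesis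
      unfolding f_def using t speed_pos by (simp add: power_mult_distrib)
  qed
  \<comment> \<open>In the variable \<open>x / d\<close> the density is minus the derivative of
    \<open>max_survival\<close>, times the chain rule factor \<open>1 / d\<close>. The 2 in front
    cancels the one left over from \<open>(2 * d) ^ (2 * k + 1)\<close>.\<close>
  have f_eq: "f x = fact (2 * k + 1) / (fact k)\<^sup>2 * ((1 - (x / d)\<^sup>2) ^ k / 4 ^ k) * (1 / d)" for x
  proof -
    have "1 - (x / d)\<^sup>2 = (d\<^sup>2 - x\<^sup>2) / d\<^sup>2"
      using d by (simp add: power_divide diff_divide_distrib)
    moreover have "(2 * d) ^ (2 * k + 1) = 2 * d * (4 ^ k * (d\<^sup>2) ^ k)"
      by (simp add: power_mult power_mult_distrib)
    moreover have "c\<^sup>2 * t\<^sup>2 = d\<^sup>2" "2 * c * t = 2 * d"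
      by (simp_all add: d_def power_mult_distrib)
    ultimately show ?thesis
      unfolding f_def by (simp only: power_divide) (simp add: mult_ac)
  qed
  have deriv: "((\<lambda>x. - max_survival n (x / d)) has_field_derivative f x) (at x)" for x
  proof -
    have "((\<lambda>x. x / d) has_field_derivative 1 / d) (at x)"
      using d by (auto intro!: derivative_eq_intros)
    from DERIV_minus[OF DERIV_chain2[OF DERIV_max_survival[OF n] this]]
    show ?thesis unfolding f_eq by simp
  qed
  have pA: "0 < prob A"
    using t rate_pos by (simp add: A_def prob_velocity_count prob_count)
  have eA: "emeasure M A \<noteq> 0" "emeasure M A \<noteq> \<infinity>"
    using pA by (auto simp: emeasure_eq_measure)
  \<comment> \<open>Extended by 0, \<open>f\<close> carries the whole conditional law, so the law is
    identified on the real line by its distribution function and restricted afterwards.\<close>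
  have "distributed U lborel X (\<lambda>x. f x * indicator {0<..<d} x)"
  proof (rule distributedI_borel_atMost[where g = "\<lambda>a. 1 - max_survival n (max 0 (min a d) / d)"])
    show "X \<in> borel_measurable U"
      using X by (simp add: U_def)
    show "(\<lambda>x. f x * indicator {0<..<d} x) \<in> borel_measurable borel"
      by measurable
    show "AE x in lborel. 0 \<le> f x * indicator {0<..<d} x"
      using f_nonneg by (auto simp: indicator_def)
    fix a
    define b where "b = max 0 (min a d)"
    have "(\<integral>\<^sup>+x. ennreal (f x * indicator {0<..<d} x * indicator {..a} x) \<partial>lborel) =
        (\<integral>\<^sup>+x. ennreal (f x) * indicator {0..b} x \<partial>lborel)"
    proof (rule nn_integral_cong_AE)
      \<comment> \<open>The integrands differ at most at the endpoints 0 and \<open>d\<close>; the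
        closed interval is the one the fundamental theorem needs.\<close>
      show "AE x in lborel. ennreal (f x * indicator {0<..<d} x * indicator {..a} x) = ennreal (f x) * indicator {0..b} x"
        using AE_lborel_singleton[of 0] AE_lborel_singleton[of d]
        by eventually_elim (use d in \<open>auto simp: indicator_def b_def\<close>)
    qed
    also have "\<dots> = ennreal (- max_survival n (b / d) - (- max_survival n (0 / d)))"
      using d by (intro nn_integral_FTC_Icc f_borel deriv f_nonneg)
        (auto simp: b_def)
    finally show "(\<integral>\<^sup>+x. ennreal (f x * indicator {0<..<d} x * indicator {..a} x) \<partial>lborel) =
        ennreal (1 - max_survival n (max 0 (min a d) / d))"
      by (simp add: max_survival_0 b_def)
    have "emeasure U {x \<in> space U. X x \<le> a} = ennreal (prob (A \<inter> {\<omega> \<in> space M. X \<omega> \<le> a})) / ennreal (prob A)"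
      unfolding U_def by (simp add: emeasure_uniform_measure[OF A] emeasure_eq_measure)
    also have "\<dots> = ennreal (prob (A \<inter> {\<omega> \<in> space M. X \<omega> \<le> a}) / prob A)"
      using pA by (intro divide_ennreal) auto
    also have "\<dots> = ennreal (1 - max_survival n (max 0 (min a d) / d))"
      using pA by (simp add: prob_max_le[OF t n, folded A_def X_def d_def])
    finally show "emeasure U {x \<in> space U. X x \<le> a} = ennreal (1 - max_survival n (max 0 (min a d) / d))" .
  qed
  then have distr: "distr U borel X = density lborel (\<lambda>x. ennreal (f x * indicator {0<..<d} x))"
    unfolding distributed_def by (metis distr_cong sets_lborel)
  have "restrict_space (distr U borel X) {0<..<d} = density (restrict_space lborel {0<..<d}) (\<lambda>x. ennreal (f x))"
  proof (rule measure_eqI)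
    show "sets (restrict_space (distr U borel X) {0<..<d}) = sets (density (restrict_space lborel {0<..<d}) (\<lambda>x. ennreal (f x)))"
      by (simp add: sets_restrict_space)
    fix B assume "B \<in> sets (restrict_space (distr U borel X) {0<..<d})"
    then have B: "B \<in> sets borel" "B \<subseteq> {0<..<d}"
      by (auto simp: sets_restrict_space)
    have BI: "B \<in> sets (restrict_space lborel {0<..<d})"
      using B by (auto simp: sets_restrict_space)
    have "emeasure (restrict_space (distr U borel X) {0<..<d}) B = emeasure (distr U borel X) B"
      using B by (intro emeasure_restrict_space) auto
    also have "\<dots> = (\<integral>\<^sup>+x. ennreal (f x * indicator {0<..<d} x) * indicator B x \<partial>lborel)"
      unfolding distr using B by (intro emeasure_density) auto
    also have "\<dots> = (\<integral>\<^sup>+x. ennreal (f x) * indicator B x * indicator {0<..<d} x \<partial>lborel)"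
      by (intro nn_integral_cong) (auto simp: indicator_def)
    also have "\<dots> = (\<integral>\<^sup>+x. ennreal (f x) * indicator B x \<partial>restrict_space lborel {0<..<d})"
      by (intro nn_integral_restrict_space[symmetric]) simp
    also have "\<dots> = emeasure (density (restrict_space lborel {0<..<d}) (\<lambda>x. ennreal (f x))) B"
      using BI by (intro emeasure_density[symmetric] measurable_restrict_space1) auto
    finally show "emeasure (restrict_space (distr U borel X) {0<..<d}) B =
        emeasure (density (restrict_space lborel {0<..<d}) (\<lambda>x. ennreal (f x))) B" .
  qed
  moreover have "f \<in> borel_measurable (restrict_space borel {0<..<d})"
    by (rule measurable_restrict_space1[OF f_borel])
  ultimately show ?thesis
    using X f_nonneg unfolding has_cond_density_on_def U_def A_def X_def d_def f_def by auto
qed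

lemma telegraph_max_cond_no_switch:
  assumes "0 < t"
  shows "\<P>(\<omega> in M. telegraph_max V0 N t \<omega> = c * t \<bar> V0 \<omega> = c \<and> N t \<omega> = 0) = 1"
proof -
  have "{\<omega> \<in> space M. telegraph_max V0 N t \<omega> = c * t \<and> V0 \<omega> = c \<and> N t \<omega> = 0} =
      {\<omega> \<in> space M. V0 \<omega> = c \<and> N t \<omega> = 0}"
    using telegraph_max_no_switch assms by auto
  \<comment> \<open>The conditional probability is a quotient, which would be 0 for a null
    condition.\<close>
  moreover have "prob {\<omega> \<in> space M. V0 \<omega> = c \<and> N t \<omega> = 0} \<noteq> 0"
    using assms by (simp add: prob_velocity_count prob_count)
  ultimately show ?thesis
    by (simp add: cond_prob_def)
qed

end

theorem theorem3p2:
  fixes M :: "'a measure" and rate c t :: real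
    and N :: "real \<Rightarrow> 'a \<Rightarrow> nat" and V0 :: "'a \<Rightarrow> real"
  assumes "symmetric_telegraph M rate N c V0"
    and "0 < t"
  shows "(\<forall>k::nat. 1 \<le> k \<longrightarrow> (\<forall>n\<in>{2 * k + 2, 2 * k + 1}.
      has_cond_density_on M (telegraph_max V0 N t)
        {\<omega> \<in> space M. V0 \<omega> = c \<and> N t \<omega> = n} {0<..<c * t}
        (\<lambda>\<beta>. 2 * (fact (2 * k + 1) / (fact k)\<^sup>2) *
              ((c\<^sup>2 * t\<^sup>2 - \<beta>\<^sup>2) ^ k / (2 * c * t) ^ (2 * k + 1)))))
    \<and> \<P>(\<omega> in M. telegraph_max V0 N t \<omega> = c * t \<bar> V0 \<omega> = c \<and> N t \<omega> = 0) = 1"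
proof -
  interpret symmetric_telegraph M rate N c V0 by fact
  show ?thesis
    using telegraph_max_has_cond_density[OF \<open>0 < t\<close>] telegraph_max_cond_no_switch[OF \<open>0 < t\<close>] by blast
qed

end
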